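(* Assume that the Compatibility Assumption (stated in the context) holds and that for all $x\in\mathbb R^d$ and $S\in\mathcal Z^n$, $\delta_xP_S\ll\delta_xP$. Then, for all $S\in\mathcal Z^n$ and $t>0$, $$\Delta_{P,P_S}(v_t)\le\int\inf_{q>0}\left(\frac1q\mathrm{KL}(\delta_xP_S\,\|\,\delta_xP)+q\,\mathrm I(q,x,t)\right)d\rho_t^S(x),$$ where, with the normalized entropy $\overline{\mathrm{Ent}}_\nu(f):=\nu(f)^{-1}\mathrm{Ent}_\nu(f)$, $$\mathrm I(q,x,t):=\frac1q\int_0^q\overline{\mathrm{Ent}}_{\delta_xP}(v_t^\epsilon)\frac{d\epsilon}{\epsilon^2},$$ and, for $\rho_t^S$-almost every $x$, $\mathrm I(q,x,t)\to\frac12\mathrm{Var}_{\delta_xP}(\log v_t)$ as $q\to0^+$.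
   Context: $\mathcal P(\mathbb R^d)$ is the set of Borel probability measures on $\mathbb R^d$. For a Markov kernel $K$ on $\mathbb R^d$: $Kf(x)=\int f(y)\,K(x,dy)$, $\mu K(A)=\int K(x,A)\,d\mu(x)$, and $\delta_xK=K(x,\cdot)$. For $\nu\in\mathcal P(\mathbb R^d)$, $\nu(f)=\int f\,d\nu$, and $\mathrm{Ent}_\nu(f)=\nu(\Phi(f))-\Phi(\nu(f))$ with $\Phi(x)=x\log x$, $\Phi(0)=0$. $(\mathcal Z,\mathcal F)$ is a measurable space, $n\ge1$. For each $S\in\mathcal Z^n$, $(X^S_k)_{k\in\mathbb N}$ is a time-homogeneous Markov chain on $\mathbb R^d$ with Markov kernel $P_S$ and initial law $\mu_0\in\mathcal P(\mathbb R^d)$. $(N_t)_{t\ge0}$ is a Poisson process of intensity $1$ independent of all other random variables; $Y^S_t:=X^S_{N_t}$ and $\rho_t^S$ is the law of $Y_t^S$ for fixed $S$. Prior: $P$ is a Markov kernel on $\mathbb R^d$ not depending on $S$, and $\pi\in\mathcal P(\mathbb R^d)$ satisfies $\pi P=\pi$. It is assumed that $\mu_0\ll\pi$. Write $v_t:=\frac{d\rho_t^S}{d\pi}$, and $\Delta_{P,P_S}(f):=\int f\,(P_S-P)(\log f)\,d\pi$. Dual operator: if $K$ is a Markov kernel such that $\mu\ll\pi\Rightarrow\mu K\ll\pi$, then $K^\star:L^1(\pi)\to L^1(\pi)$ is defined on non-negative $f$ with $\int f\,d\pi=1$ by $K^\star f=\frac{d(\mu K)}{d\pi}$ with $d\mu=f\,d\pi$,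 and extended linearly. Compatibility Assumption: $\mathrm{KL}(\mu_0\|\pi)<+\infty$; $v_0=d\mu_0/d\pi$ is bounded away from $0$; for all $t\ge0$ the map $S\mapsto\mathrm{KL}(\rho_t^S\|\pi)$ is $\mathcal F^{\otimes n}$-measurable; and for all $S\in\mathcal Z^n$: (H.1) for all $\mu\in\mathcal P(\mathbb R^d)$, $\mu\ll\pi$ implies $\mu P_S\ll\pi$; (H.2) for all $t\ge0$, $\Phi(P_S^\star v_t)\in L^1(\pi)$. *)

theory Defs
  imports "HOL-Probability.Probability"
begin

text \<open>
  A Markov kernel on a measurable space \<open>B\<close> is an element of \<open>B \<rightarrow>\<^sub>M prob_algebra B\<close>; for such a
  kernel \<open>K\<close> and a measure \<open>\<mu>\<close>, the measure \<open>\<mu> K\<close> is \<open>\<mu> \<bind> K\<close>, and \<open>\<delta>\<^sub>x K\<close> is \<open>K x\<close>.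
\<close>

definition kernel_op :: "('a \<Rightarrow> 'a measure) \<Rightarrow> ('a \<Rightarrow> real) \<Rightarrow> 'a \<Rightarrow> real" where
  "kernel_op K f x = (\<integral>y. f y \<partial>K x)"

text \<open>The sigma-algebra on the space of \<open>M\<close> generated by \<open>X 0, \<dots>, X k\<close>.\<close>

definition past_algebra :: "'w measure \<Rightarrow> (nat \<Rightarrow> 'w \<Rightarrow> 'a::topological_space) \<Rightarrow> nat \<Rightarrow> 'w measure" where
  "past_algebra M X k =
     vimage_algebra (space M) (\<lambda>\<omega>. \<lambda>i\<in>{..k}. X i \<omega>) (\<Pi>\<^sub>M i\<in>{..k}. borel)"

definition markov_chain ::
    "'w measure \<Rightarrow> (nat \<Rightarrow> 'w \<Rightarrow> 'a::topological_space) \<Rightarrow> 'a measure \<Rightarrow> ('a \<Rightarrow> 'a measure) \<Rightarrow> bool" where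
  "markov_chain M X \<mu>0 K \<longleftrightarrow>
     prob_space M \<and>
     (\<forall>k. X k \<in> borel_measurable M) \<and>
     distr M borel (X 0) = \<mu>0 \<and>
     (\<forall>k. \<forall>A\<in>sets borel. AE \<omega> in M.
        real_cond_exp M (past_algebra M X k) (\<lambda>\<omega>'. indicator A (X (Suc k) \<omega>')) \<omega>
          = measure (K (X k \<omega>)) A)"

text \<open>
  The subtractions are on natural numbers; they are the increments because almost every path is
  nondecreasing. Right-continuity is for the discrete topology of the natural numbers.
\<close>

definition poisson_process :: "'w measure \<Rightarrow> real \<Rightarrow> (real \<Rightarrow> 'w \<Rightarrow> nat) \<Rightarrow> bool" where
  "poisson_process M r N \<longleftrightarrow>
     prob_space M \<and>
     (\<forall>t\<ge>0. N t \<in> M \<rightarrow>\<^sub>M count_space UNIV) \<and>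
     (AE \<omega> in M. N 0 \<omega> = 0 \<and> mono_on {0..} (\<lambda>t. N t \<omega>) \<and>
        (\<forall>t\<ge>0. continuous (at_right t) (\<lambda>s. N s \<omega>))) \<and>
     (\<forall>s t. 0 \<le> s \<and> s < t \<longrightarrow>
        distr M (count_space UNIV) (\<lambda>\<omega>. N t \<omega> - N s \<omega>) = measure_pmf (poisson_pmf (r * (t - s)))) \<and>
     (\<forall>(m::nat) \<tau>. 0 \<le> \<tau> 0 \<and> (\<forall>i<m. \<tau> i \<le> \<tau> (Suc i)) \<longrightarrow>
        prob_space.indep_vars M (\<lambda>_. count_space UNIV)
          (\<lambda>i \<omega>. N (\<tau> (Suc i)) \<omega> - N (\<tau> i) \<omega>) {..<m})"

definition indep_processes ::
    "'w measure \<Rightarrow> (nat \<Rightarrow> 'w \<Rightarrow> 'a::topological_space) \<Rightarrow> (real \<Rightarrow> 'w \<Rightarrow> nat) \<Rightarrow> bool" where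
  "indep_processes M X N \<longleftrightarrow>
     prob_space.indep_set M
       (sets (vimage_algebra (space M) (\<lambda>\<omega> k. X k \<omega>) (\<Pi>\<^sub>M k\<in>UNIV. borel)))
       (sets (vimage_algebra (space M) (\<lambda>\<omega>. \<lambda>t\<in>{0..}. N t \<omega>) (\<Pi>\<^sub>M t\<in>{0..}. count_space UNIV)))"

definition subordinated_law ::
    "'w measure \<Rightarrow> (nat \<Rightarrow> 'w \<Rightarrow> 'a::topological_space) \<Rightarrow> (real \<Rightarrow> 'w \<Rightarrow> nat) \<Rightarrow> real \<Rightarrow> 'a measure" where
  "subordinated_law M X N t = distr M borel (\<lambda>\<omega>. X (N t \<omega>) \<omega>)"

definition dens :: "'a measure \<Rightarrow> 'a measure \<Rightarrow> 'a \<Rightarrow> real" where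
  "dens \<pi> \<mu> x = enn2real (RN_deriv \<pi> \<mu> x)"

definition Phi :: "real \<Rightarrow> real" where
  "Phi x = x * ln x"

text \<open>
  The library's divergence is real-valued and takes the reference measure first. The negative part
  of the log-density is always integrable with respect to \<open>\<mu>\<close>, so a non-integrable log-density
  means that the divergence is infinite. Truncation by \<open>ennreal\<close> is harmless by Gibbs' inequality.
\<close>

definition KL :: "'a measure \<Rightarrow> 'a measure \<Rightarrow> ennreal" where
  "KL \<mu> \<nu> =
     (if absolutely_continuous \<nu> \<mu> \<and> integrable \<mu> (entropy_density (exp 1) \<nu> \<mu>)
      then ennreal (KL_divergence (exp 1) \<nu> \<mu>) else \<infinity>)"

text \<open>
  For \<open>f \<ge> 0\<close> measurable and \<open>\<nu>\<close> a probability measure, \<open>Phi \<circ> f\<close> is bounded below, so it is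
  integrable iff \<open>\<nu>(Phi(f))\<close> is finite, and then \<open>\<nu>(f)\<close> is finite as well. The entropy, and hence the
  normalized entropy, is \<open>\<infinity>\<close> when \<open>\<nu>(Phi(f)) = \<infinity>\<close>, including the case \<open>\<nu>(f) = \<infinity>\<close>.
\<close>

definition Ent :: "'a measure \<Rightarrow> ('a \<Rightarrow> real) \<Rightarrow> ereal" where
  "Ent \<nu> f =
     (if integrable \<nu> (\<lambda>x. Phi (f x))
      then ereal ((\<integral>x. Phi (f x) \<partial>\<nu>) - Phi (\<integral>x. f x \<partial>\<nu>)) else \<infinity>)"

definition nEnt :: "'a measure \<Rightarrow> ('a \<Rightarrow> real) \<Rightarrow> ereal" where
  "nEnt \<nu> f = (if Ent \<nu> f = \<infinity> then \<infinity> else Ent \<nu> f / ereal (\<integral>x. f x \<partial>\<nu>))"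

text \<open>
  The dual operator on probability densities \<open>f\<close> with respect to \<open>\<pi>\<close>; it is only ever
  applied to such functions, so its linear extension is not needed.
\<close>

definition dual_op :: "'a measure \<Rightarrow> ('a \<Rightarrow> 'a measure) \<Rightarrow> ('a \<Rightarrow> real) \<Rightarrow> 'a \<Rightarrow> real" where
  "dual_op \<pi> K f = dens \<pi> (density \<pi> (\<lambda>x. ennreal (f x)) \<bind> K)"

definition Delta ::
    "'a measure \<Rightarrow> ('a \<Rightarrow> 'a measure) \<Rightarrow> ('a \<Rightarrow> 'a measure) \<Rightarrow> ('a \<Rightarrow> real) \<Rightarrow> real" where
  "Delta \<pi> P Q f =
     (\<integral>x. f x * (kernel_op Q (\<lambda>y. ln (f y)) x - kernel_op P (\<lambda>y. ln (f y)) x) \<partial>\<pi>)"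

text \<open>
  The normalized entropy of a nonnegative function under a probability measure is nonnegative by
  Jensen's inequality, so passing to \<open>ennreal\<close> loses nothing.
\<close>

definition I_ent :: "('a \<Rightarrow> 'a measure) \<Rightarrow> ('a \<Rightarrow> real) \<Rightarrow> real \<Rightarrow> 'a \<Rightarrow> ennreal" where
  "I_ent P v q x =
     ennreal (1 / q) *
     (\<integral>\<^sup>+\<epsilon>\<in>{0<..<q}. e2ennreal (nEnt (P x) (\<lambda>y. v y powr \<epsilon>)) * ennreal (1 / \<epsilon>\<^sup>2) \<partial>lborel)"

text \<open>
  \<open>D\<close> is the measurable space of data sets, \<open>PS s\<close> and \<open>\<rho> s t\<close> the kernel and the time-\<open>t\<close> law
  for the data set \<open>s\<close>.
\<close>

definition compatible ::
    "'s measure \<Rightarrow> 'a::topological_space measure \<Rightarrow> 'a measure \<Rightarrow> ('s \<Rightarrow> 'a \<Rightarrow> 'a measure) \<Rightarrow>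
     ('s \<Rightarrow> real \<Rightarrow> 'a measure) \<Rightarrow> bool" where
  "compatible D \<pi> \<mu>0 PS \<rho> \<longleftrightarrow>
     KL \<mu>0 \<pi> < \<infinity> \<and>
     (\<exists>c>0. AE x in \<pi>. c \<le> dens \<pi> \<mu>0 x) \<and>
     (\<forall>t\<ge>0. (\<lambda>s. KL (\<rho> s t) \<pi>) \<in> borel_measurable D) \<and>
     (\<forall>s\<in>space D.
        (\<forall>\<mu>\<in>space (prob_algebra borel).
           absolutely_continuous \<pi> \<mu> \<longrightarrow> absolutely_continuous \<pi> (\<mu> \<bind> PS s)) \<and>
        (\<forall>t\<ge>0. integrable \<pi> (\<lambda>x. Phi (dual_op \<pi> (PS s) (dens \<pi> (\<rho> s t)) x))))"

end

theory Submission
  imports Defs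
begin

text \<open>
  Write \<open>f = ln v\<close>, \<open>Q = P x\<close> and \<open>R = PS S x\<close>. The Donsker--Varadhan inequality gives
  \<open>q * (R f - Q f) \<le> KL R Q + (ln (Q (exp (q * f))) - q * Q f)\<close>, and by Herbst's argument the last
  term is at most \<open>q\<^sup>2 * I_ent P v q x\<close>. Integrating against \<open>\<rho>\<close>, the law with density \<open>v\<close>, yields the
  bound on \<open>Delta\<close>.
  At time \<open>t\<close> no jump has occurred with probability \<open>exp (- t)\<close>, so \<open>v\<close> inherits from \<open>\<mu>0\<close> a positive
  lower bound. Invariance of \<open>\<pi>\<close> transfers this bound and the integrability of \<open>v\<close> to almost
  every \<open>P x\<close>, while \<open>w * ln v \<le> w * ln w - w + v\<close>, with \<open>w\<close> the density of \<open>\<rho> \<bind> PS S\<close>, makes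
  \<open>ln v\<close> integrable under almost every \<open>PS S x\<close>. Since \<open>f\<close> is bounded below and \<open>Q (exp f)\<close> is finite,
  the cumulant generating function of \<open>f\<close> is smooth around \<open>0\<close>, which gives the limit of \<open>I_ent\<close>.
\<close>

subsection \<open>Exponential moments and cumulants\<close>

text \<open>This dominates every weighted power below \<open>b\<close> by the single exponential at
  \<open>b\<close>. With \<open>d = b - s\<close>, the case \<open>u \<ge> 0\<close> raises
  \<open>y \<le> exp y\<close> at \<open>y = d * u / k\<close> to the power \<open>k\<close>. For
  \<open>u < 0\<close> the lower bound confines \<open>\<bar>u\<bar>\<close> to
  \<open>\<bar>c\<bar>\<close>, and \<open>exp (d * \<bar>c\<bar>)\<close> compensates for
  \<open>exp (d * u) < 1\<close>.\<close>

lemma power_abs_exp_le: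
  fixes c s b u :: real and k :: nat
  assumes "s < b" "c \<le> u"
  shows "\<bar>u\<bar> ^ k * exp (s * u)
    \<le> ((real k / (b - s)) ^ k + \<bar>c\<bar> ^ k * exp ((b - s) * \<bar>c\<bar>)) * exp (b * u)"
proof -
  define d where "d = b - s"
  have d: "d > 0" using assms by (simp add: d_def)
  have "\<bar>u\<bar> ^ k \<le> ((real k / d) ^ k + \<bar>c\<bar> ^ k * exp (d * \<bar>c\<bar>)) * exp (d * u)"
  proof (cases "u \<ge> 0")
    case True
    have "u ^ k \<le> (real k / d) ^ k * exp (d * u)"
    \<comment> \<open>The argument divides by \<open>k\<close>; for \<open>k = 0\<close> the
      constant is \<open>0 ^ 0 = 1\<close>.\<close>
    proof (cases "k = 0")
      case True
      then show ?thesis using d \<open>u \<ge> 0\<close> by simp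
    next
      case False
      have "d * u / k \<le> exp (d * u / k)"
        using exp_ge_add_one_self[of "d * u / k"] by linarith
      then have "u \<le> real k / d * exp (d * u / k)"
        using d False by (simp add: field_simps)
      then have "u ^ k \<le> (real k / d * exp (d * u / k)) ^ k"
        using True by (intro power_mono) auto
      also have "\<dots> = (real k / d) ^ k * exp (d * u)"
        unfolding power_mult_distrib using False by (simp flip: exp_of_nat_mult)
      finally show ?thesis .
    qed
    also have "\<dots> \<le> ((real k / d) ^ k + \<bar>c\<bar> ^ k * exp (d * \<bar>c\<bar>)) * exp (d * u)"
      by (intro mult_right_mono) auto
    finally show ?thesis using True by simp
  next
    case False
    have "\<bar>u\<bar> ^ k \<le> \<bar>c\<bar> ^ k"
      using False assms by (intro power_mono) auto
    also have "\<dots> \<le> \<bar>c\<bar> ^ k * (exp (d * \<bar>c\<bar>) * exp (d * u))"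
    proof -
      have "0 \<le> d * \<bar>c\<bar> + d * u"
        using False assms d by (simp flip: distrib_left)
      then have "1 \<le> exp (d * \<bar>c\<bar>) * exp (d * u)"
        by (simp flip: exp_add)
      then show ?thesis
        using mult_left_mono[of 1 "exp (d * \<bar>c\<bar>) * exp (d * u)" "\<bar>c\<bar> ^ k"] by simp
    qed
    also have "\<dots> \<le> ((real k / d) ^ k + \<bar>c\<bar> ^ k * exp (d * \<bar>c\<bar>)) * exp (d * u)"
      using d by (simp add: distrib_right)
    finally show ?thesis .
  qed
  then have "\<bar>u\<bar> ^ k * exp (s * u)
    \<le> ((real k / d) ^ k + \<bar>c\<bar> ^ k * exp (d * \<bar>c\<bar>)) * exp (d * u) * exp (s * u)"
    by (intro mult_right_mono) auto
  also have "\<dots> = ((real k / d) ^ k + \<bar>c\<bar> ^ k * exp (d * \<bar>c\<bar>)) * exp (b * u)"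
    by (simp add: d_def algebra_simps flip: exp_add)
  finally show ?thesis by (simp add: d_def)
qed

text \<open>Taylor's formula with Lagrange remainder; the constant is crude because only the order
  \<open>u\<^sup>2\<close> matters for difference quotients.\<close>

lemma abs_exp_minus_linear_le:
  fixes u :: real
  shows "\<bar>exp u - 1 - u\<bar> \<le> u\<^sup>2 * exp \<bar>u\<bar>"
proof -
  obtain t where t: "\<bar>t\<bar> \<le> \<bar>u\<bar>" "exp u = (\<Sum>m<2. u ^ m / fact m) + exp t / fact 2 * u ^ 2"
    using Maclaurin_exp_le[of u 2] by auto
  then have "exp u - 1 - u = exp t / 2 * u\<^sup>2"
    by (simp add: numeral_2_eq_2)
  moreover have "exp t / 2 \<le> exp \<bar>u\<bar>"
    using t(1) by (smt (verit) exp_ge_zero exp_le_cancel_iff field_sum_of_halves)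
  ultimately have "\<bar>exp u - 1 - u\<bar> \<le> exp \<bar>u\<bar> * u\<^sup>2"
    by (simp only: abs_mult abs_power2) (intro mult_right_mono, auto)
  then show ?thesis by (simp add: mult.commute)
qed

lemma (in prob_space) expectation_exp_pos:
  assumes "integrable M (\<lambda>x. exp (f x :: real))"
  shows "0 < expectation (\<lambda>x. exp (f x))"
proof (rule order.not_eq_order_implies_strict)
  show "0 \<noteq> expectation (\<lambda>x. exp (f x))"
    using assms by (subst eq_commute, subst integral_nonneg_eq_0_iff_AE) auto
qed (intro integral_nonneg_AE, auto)

section \<open>The moment generating function and its derivatives\<close>

definition exp_moment :: "'a measure \<Rightarrow> ('a \<Rightarrow> real) \<Rightarrow> nat \<Rightarrow> real \<Rightarrow> real" where
  "exp_moment Q f k s = (\<integral>x. f x ^ k * exp (s * f x) \<partial>Q)"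

text \<open>A lower bound together with one positive exponential moment makes the moment generating
  function finite for all \<open>s < b\<close>, negative \<open>s\<close> included, so that
  \<open>0\<close> is an interior point.\<close>

locale bounded_below_exp = prob_space Q for Q :: "'a measure" +
  fixes f :: "'a \<Rightarrow> real" and c b :: real
  assumes meas [measurable]: "f \<in> borel_measurable Q"
    and lower: "AE x in Q. c \<le> f x"
    and b_pos: "0 < b"
    and exp_int: "integrable Q (\<lambda>x. exp (b * f x))"
begin

lemma abs_moment_integrable:
  assumes "s < b"
  shows "integrable Q (\<lambda>x. \<bar>f x\<bar> ^ k * exp (s * f x))"
proof (rule Bochner_Integration.integrable_bound)
  show "integrable Q (\<lambda>x. ((real k / (b - s)) ^ k + \<bar>c\<bar> ^ k * exp ((b - s) * \<bar>c\<bar>)) * exp (b * f x))"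
    using exp_int by simp
  show "AE x in Q. norm (\<bar>f x\<bar> ^ k * exp (s * f x)) \<le>
     norm (((real k / (b - s)) ^ k + \<bar>c\<bar> ^ k * exp ((b - s) * \<bar>c\<bar>)) * exp (b * f x))"
    using lower
  proof eventually_elim
    case (elim x)
    have "norm (\<bar>f x\<bar> ^ k * exp (s * f x)) = \<bar>f x\<bar> ^ k * exp (s * f x)"
      by (simp add: abs_mult)
    also note power_abs_exp_le[OF assms elim, of k]
    also note abs_ge_self
    finally show ?case by simp
  qed
qed measurable

lemma moment_integrable:
  assumes "s < b"
  shows "integrable Q (\<lambda>x. f x ^ k * exp (s * f x))"
  by (rule Bochner_Integration.integrable_bound[OF abs_moment_integrable[OF assms, of k]])
     (auto simp: abs_mult power_abs)

text \<open>Differentiation under the integral sign with an explicit rate: the pointwise Taylor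
  remainder is of order \<open>h\<^sup>2\<close> with an integrable factor, so the difference
  quotient errs by at most \<open>\<bar>h\<bar> * C\<close>.\<close>

lemma has_real_derivative_exp_moment:
  assumes "s < b"
  shows "(exp_moment Q f k has_real_derivative exp_moment Q f (Suc k) s) (at s)"
proof -
  \<comment> \<open>Half the distance to \<open>b\<close>, so that both \<open>s + h\<close> and the
    dominating exponent \<open>s + d\<close> stay below \<open>b\<close>.\<close>
  define d where "d = (b - s) / 2"
  have d: "d > 0" "s + d < b" using assms by (auto simp: d_def field_simps)
  define C where "C = (\<integral>x. exp (2 * d * \<bar>c\<bar>) * (\<bar>f x\<bar> ^ (k + 2) * exp ((s + d) * f x)) \<partial>Q)"
  have quot: "\<bar>(exp_moment Q f k (s + h) - exp_moment Q f k s) / h - exp_moment Q f (Suc k) s\<bar> \<le> \<bar>h\<bar> * C"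
    if h: "h \<noteq> 0" "\<bar>h\<bar> < d" for h
  proof -
    have sh: "s + h < b" using h d by simp
    note int = moment_integrable[OF sh, of k] moment_integrable[OF assms, of k]
      moment_integrable[OF assms, of "Suc k"]
    have eq: "exp_moment Q f k (s + h) - exp_moment Q f k s - h * exp_moment Q f (Suc k) s
        = (\<integral>x. f x ^ k * exp ((s + h) * f x) - f x ^ k * exp (s * f x)
              - h * (f x ^ Suc k * exp (s * f x)) \<partial>Q)"
      unfolding exp_moment_def using int by (simp del: power_Suc)
    have "\<bar>\<dots>\<bar> \<le> (\<integral>x. h\<^sup>2 * (exp (2 * d * \<bar>c\<bar>) * (\<bar>f x\<bar> ^ (k + 2) * exp ((s + d) * f x))) \<partial>Q)"
    proof (rule order_trans[OF integral_abs_bound integral_mono_AE])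
      show "integrable Q (\<lambda>x. h\<^sup>2 * (exp (2 * d * \<bar>c\<bar>) * (\<bar>f x\<bar> ^ (k + 2) * exp ((s + d) * f x))))"
        using abs_moment_integrable[OF d(2), of "k + 2"] by (intro integrable_mult_right)
    next
      show "AE x in Q. \<bar>f x ^ k * exp ((s + h) * f x) - f x ^ k * exp (s * f x)
              - h * (f x ^ Suc k * exp (s * f x))\<bar>
           \<le> h\<^sup>2 * (exp (2 * d * \<bar>c\<bar>) * (\<bar>f x\<bar> ^ (k + 2) * exp ((s + d) * f x)))"
        using lower
      proof eventually_elim
        case (elim x)
        have "\<bar>h * f x\<bar> \<le> d * \<bar>f x\<bar>"
          using h by (simp add: abs_mult mult_right_mono)
        \<comment> \<open>Since \<open>c \<le> f x\<close>, the absolute value costs only the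
          constant \<open>2 * \<bar>c\<bar>\<close>; this turns the two-sided exponential into
          \<open>exp (d * f x)\<close> times a constant.\<close>
        also have "\<dots> \<le> d * (f x + 2 * \<bar>c\<bar>)"
          using elim d by (intro mult_left_mono) auto
        finally have le: "exp \<bar>h * f x\<bar> \<le> exp (2 * d * \<bar>c\<bar>) * exp (d * f x)"
          by (simp add: algebra_simps flip: exp_add)
        have "f x ^ k * exp ((s + h) * f x) - f x ^ k * exp (s * f x) - h * (f x ^ Suc k * exp (s * f x))
           = f x ^ k * exp (s * f x) * (exp (h * f x) - 1 - h * f x)"
          by (simp add: algebra_simps exp_add)
        also have "\<bar>\<dots>\<bar> \<le> \<bar>f x\<bar> ^ k * exp (s * f x) * ((h * f x)\<^sup>2 * exp \<bar>h * f x\<bar>)"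
          using abs_exp_minus_linear_le[of "h * f x"]
          by (auto simp: abs_mult power_abs intro!: mult_left_mono)
        also have "\<dots> \<le> \<bar>f x\<bar> ^ k * exp (s * f x) * ((h * f x)\<^sup>2 * (exp (2 * d * \<bar>c\<bar>) * exp (d * f x)))"
          using le by (intro mult_left_mono) auto
        also have "\<dots> = h\<^sup>2 * (exp (2 * d * \<bar>c\<bar>) * (\<bar>f x\<bar> ^ (k + 2) * exp ((s + d) * f x)))"
          by (simp add: power_add power_mult_distrib exp_add algebra_simps flip: power2_eq_square)
        finally show ?case .
      qed
    qed (use int in \<open>auto simp del: power_Suc intro!: integrable_abs\<close>)
    also have "\<dots> = h\<^sup>2 * C"
      by (simp add: C_def)
    finally have le: "\<bar>exp_moment Q f k (s + h) - exp_moment Q f k s - h * exp_moment Q f (Suc k) s\<bar> \<le> h\<^sup>2 * C"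
      unfolding eq .
    have "(exp_moment Q f k (s + h) - exp_moment Q f k s) / h - exp_moment Q f (Suc k) s
       = (exp_moment Q f k (s + h) - exp_moment Q f k s - h * exp_moment Q f (Suc k) s) / h"
      using h by (simp add: field_simps)
    also have "\<bar>\<dots>\<bar> \<le> h\<^sup>2 * C / \<bar>h\<bar>"
      using le by (simp add: divide_right_mono)
    also have "\<dots> = \<bar>h\<bar> * C"
      using h by (simp add: power2_eq_square abs_if)
    finally show ?thesis .
  qed
  have "((\<lambda>h. (exp_moment Q f k (s + h) - exp_moment Q f k s) / h - exp_moment Q f (Suc k) s) \<longlongrightarrow> 0) (at 0)"
  proof (rule Lim_null_comparison)
    show "eventually (\<lambda>h. norm ((exp_moment Q f k (s + h) - exp_moment Q f k s) / h
        - exp_moment Q f (Suc k) s) \<le> \<bar>h\<bar> * C) (at 0)"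
      unfolding eventually_at using d quot by (intro exI[of _ d]) (auto simp: dist_real_def)
    show "((\<lambda>h. \<bar>h\<bar> * C) \<longlongrightarrow> 0) (at 0)"
      by (auto intro!: tendsto_eq_intros)
  qed
  then show ?thesis
    unfolding DERIV_def by (rule LIM_zero_cancel)
qed

lemma exp_moment_0_pos:
  assumes "s < b"
  shows "0 < exp_moment Q f 0 s"
  using expectation_exp_pos[of "\<lambda>x. s * f x"] moment_integrable[OF assms, of 0]
  by (simp add: exp_moment_def)

section \<open>The cumulant generating function and the normalized entropy\<close>

definition cumulant :: "real \<Rightarrow> real" where
  "cumulant s = ln (exp_moment Q f 0 s)"

text \<open>With \<open>L\<close> the cumulant generating function this is
  \<open>s * L' - L\<close>, the normalized entropy of \<open>exp (s * f)\<close>.\<close>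

definition entropy_fun :: "real \<Rightarrow> real" where
  "entropy_fun s = s * (exp_moment Q f 1 s / exp_moment Q f 0 s) - cumulant s"

lemma cumulant_0 [simp]: "cumulant 0 = 0"
  by (simp add: cumulant_def exp_moment_def prob_space)

lemma cumulant_deriv:
  assumes "s < b"
  shows "(cumulant has_real_derivative (exp_moment Q f 1 s / exp_moment Q f 0 s)) (at s)"
proof -
  have "((\<lambda>s. ln (exp_moment Q f 0 s)) has_real_derivative (exp_moment Q f 1 s / exp_moment Q f 0 s)) (at s)"
    using has_real_derivative_exp_moment[OF assms, of 0] exp_moment_0_pos[OF assms]
    by (auto intro!: derivative_eq_intros)
  then show ?thesis
    unfolding cumulant_def [abs_def] .
qed

lemma nEnt_exp:
  assumes "s < b"
  shows "nEnt Q (\<lambda>x. exp (s * f x)) = ereal (entropy_fun s)"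
    and "0 \<le> entropy_fun s"
proof -
  have Phi: "Phi (exp (s * f x)) = s * (f x ^ 1 * exp (s * f x))" for x
    by (simp add: Phi_def)
  have int1: "integrable Q (\<lambda>x. Phi (exp (s * f x)))"
    unfolding Phi using moment_integrable[OF assms, of 1] by (intro integrable_mult_right)
  have int0: "integrable Q (\<lambda>x. exp (s * f x))"
    using moment_integrable[OF assms, of 0] by simp
  have m1: "(\<integral>x. Phi (exp (s * f x)) \<partial>Q) = s * exp_moment Q f 1 s"
    unfolding Phi exp_moment_def by (rule integral_mult_right_zero)
  have m0: "(\<integral>x. exp (s * f x) \<partial>Q) = exp_moment Q f 0 s"
    by (simp add: exp_moment_def)
  note pos = exp_moment_0_pos[OF assms]
  have eq: "(s * exp_moment Q f 1 s - Phi (exp_moment Q f 0 s)) / exp_moment Q f 0 s = entropy_fun s"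
    using pos by (simp add: entropy_fun_def cumulant_def Phi_def diff_divide_distrib)
  show "nEnt Q (\<lambda>x. exp (s * f x)) = ereal (entropy_fun s)"
    using int1 pos by (simp add: nEnt_def Ent_def m1 m0 flip: eq)
  \<comment> \<open>Jensen's inequality for \<open>Phi\<close> by its tangent line at the mean
    \<open>m\<close>: with \<open>y = exp (s * f x)\<close>, the pointwise bound
    \<open>y - m \<le> y * ln y - y * ln m\<close> is integrated, and its left side has mean
    zero.\<close>
  have "0 = (\<integral>x. exp (s * f x) - exp_moment Q f 0 s \<partial>Q)"
    using int0 by (simp add: m0 prob_space)
  also have "\<dots> \<le> (\<integral>x. Phi (exp (s * f x)) - ln (exp_moment Q f 0 s) * exp (s * f x) \<partial>Q)"
  proof (rule integral_mono)
    fix x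
    define y where "y = exp (s * f x)"
    have y: "y > 0" by (simp add: y_def)
    have "ln (exp_moment Q f 0 s / y) \<le> exp_moment Q f 0 s / y - 1"
      using y pos by (intro ln_le_minus_one) auto
    then have "y * (ln (exp_moment Q f 0 s) - ln y) \<le> y * (exp_moment Q f 0 s / y - 1)"
      using y pos by (intro mult_left_mono) (auto simp: ln_div)
    then have "y - exp_moment Q f 0 s \<le> y * ln y - ln (exp_moment Q f 0 s) * y"
      using y by (simp add: algebra_simps)
    then show "exp (s * f x) - exp_moment Q f 0 s
        \<le> Phi (exp (s * f x)) - ln (exp_moment Q f 0 s) * exp (s * f x)"
      by (simp add: Phi_def y_def)
  qed (use int0 int1 in auto)
  also have "\<dots> = s * exp_moment Q f 1 s - Phi (exp_moment Q f 0 s)"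
    using int0 int1 by (simp add: m0 m1) (simp add: Phi_def mult.commute)
  finally show "0 \<le> entropy_fun s"
    using pos by (simp flip: eq)
qed

text \<open>Herbst's identity: the quotient rule applied to \<open>L s / s\<close> produces exactly
  \<open>s * L' - L\<close> over \<open>s\<^sup>2\<close>.\<close>

lemma cumulant_quotient_deriv:
  assumes "s < b" "s \<noteq> 0"
  shows "((\<lambda>s. cumulant s / s) has_real_derivative (entropy_fun s / s\<^sup>2)) (at s)"
  using cumulant_deriv[OF assms(1)] assms(2)
  by (auto intro!: derivative_eq_intros simp: entropy_fun_def field_simps power2_eq_square)

text \<open>As \<open>cumulant 0 = 0\<close>, the quotient is the difference quotient at
  \<open>0\<close>, where the derivative is the mean.\<close>

lemma cumulant_quotient_tendsto:
  "((\<lambda>s. cumulant s / s) \<longlongrightarrow> (\<integral>x. f x \<partial>Q)) (at_right 0)"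
proof -
  have "(cumulant has_real_derivative (\<integral>x. f x \<partial>Q)) (at 0)"
    using cumulant_deriv[of 0] b_pos by (simp add: exp_moment_def prob_space)
  then have "((\<lambda>s. cumulant s / s) \<longlongrightarrow> (\<integral>x. f x \<partial>Q)) (at 0)"
    by (simp add: DERIV_def)
  then show ?thesis
    by (rule filterlim_mono) (auto simp: at_le)
qed

lemma isCont_exp_moment: "s < b \<Longrightarrow> isCont (exp_moment Q f k) s"
  using has_real_derivative_exp_moment by (rule DERIV_isCont)

lemma variance_exp_moment:
  "variance f = exp_moment Q f 2 0 - (exp_moment Q f 1 0)\<^sup>2"
  using moment_integrable[OF b_pos, of 1] moment_integrable[OF b_pos, of 2]
  by (subst variance_eq) (auto simp: exp_moment_def)

text \<open>The derivative of \<open>s * L' - L\<close> is \<open>s * L''\<close>, so l'Hopital's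
  rule against \<open>s\<^sup>2\<close> leaves \<open>L'' / 2\<close>, and \<open>L''\<close> at
  \<open>0\<close> is the variance. \<open>L2\<close> is \<open>L''\<close> written in
  moments.\<close>

lemma entropy_fun_tendsto:
  "((\<lambda>s. entropy_fun s / s\<^sup>2) \<longlongrightarrow> variance f / 2) (at_right 0)"
proof -
  define L2 where "L2 s = (exp_moment Q f 2 s * exp_moment Q f 0 s - (exp_moment Q f 1 s)\<^sup>2)
      / (exp_moment Q f 0 s)\<^sup>2" for s
  have ev: "eventually (\<lambda>s. s < b \<and> 0 < s) (at_right 0)"
    using b_pos by (auto simp: eventually_at_right_field)
  have der: "(entropy_fun has_real_derivative s * L2 s) (at s)" if "s < b" for s
    unfolding entropy_fun_def[abs_def]
    using has_real_derivative_exp_moment[OF that, of 1] has_real_derivative_exp_moment[OF that, of 0]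
      exp_moment_0_pos[OF that] cumulant_deriv[OF that]
    by (auto intro!: derivative_eq_intros simp: L2_def field_simps power2_eq_square numeral_2_eq_2)
  show ?thesis
  proof (rule lhopital_right[where f' = "\<lambda>s. s * L2 s" and g' = "\<lambda>s. 2 * s"])
    have "isCont entropy_fun 0" using DERIV_isCont[OF der[OF b_pos]] .
    then have "(entropy_fun \<longlongrightarrow> entropy_fun 0) (at 0)" by (simp add: isCont_def)
    moreover have "entropy_fun 0 = 0" by (simp add: entropy_fun_def)
    ultimately show "(entropy_fun \<longlongrightarrow> 0) (at_right 0)"
      by (metis filterlim_at_split)
    show "((\<lambda>s::real. s\<^sup>2) \<longlongrightarrow> 0) (at_right 0)"
      by (auto intro!: tendsto_eq_intros)
    show "eventually (\<lambda>s::real. s\<^sup>2 \<noteq> 0) (at_right 0)" "eventually (\<lambda>s::real. 2 * s \<noteq> 0) (at_right 0)"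
      using ev by (auto elim!: eventually_mono)
    show "eventually (\<lambda>s. (entropy_fun has_real_derivative s * L2 s) (at s)) (at_right 0)"
      using ev by (rule eventually_mono) (simp add: der)
    show "eventually (\<lambda>s::real. ((\<lambda>s. s\<^sup>2) has_real_derivative 2 * s) (at s)) (at_right 0)"
      by (auto intro!: always_eventually derivative_eq_intros)
    have "isCont L2 0"
      unfolding L2_def[abs_def]
      using isCont_exp_moment[OF b_pos] exp_moment_0_pos[OF b_pos] by (intro continuous_intros) auto
    then have "(L2 \<longlongrightarrow> L2 0) (at 0)" by (simp add: isCont_def)
    then have "((\<lambda>s. L2 s / 2) \<longlongrightarrow> L2 0 / 2) (at_right 0)"
      by (auto intro!: tendsto_intros simp: filterlim_at_split)
    moreover have "L2 0 = variance f"
      by (simp add: L2_def variance_exp_moment) (simp add: exp_moment_def prob_space)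
    ultimately show "((\<lambda>s. s * L2 s / (2 * s)) \<longlongrightarrow> variance f / 2) (at_right 0)"
      using ev by (auto elim!: Lim_transform_eventually eventually_mono)
  qed
qed

end

subsection \<open>Entropy integrals\<close>

text \<open>Where \<open>e * f \<le> 1\<close>, \<open>exp (s * f)\<close> is at most
  \<open>exp 1\<close>; elsewhere it is at most \<open>exp (e * f)\<close>, hence at most
  \<open>Phi (exp (e * f))\<close>. So integrability of the latter would force that of
  \<open>exp (s * f)\<close>.\<close>

lemma nEnt_eq_infinity:
  assumes Q: "prob_space Q" and [measurable]: "f \<in> borel_measurable Q"
    and "0 < s" "s \<le> e" and nint: "\<not> integrable Q (\<lambda>x. exp (s * f x))"
  shows "nEnt Q (\<lambda>x. exp (e * f x)) = \<infinity>"
proof -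
  interpret prob_space Q by fact
  have "\<not> integrable Q (\<lambda>x. Phi (exp (e * f x)))"
  proof
    assume int: "integrable Q (\<lambda>x. Phi (exp (e * f x)))"
    have "integrable Q (\<lambda>x. exp (s * f x))"
    proof (rule Bochner_Integration.integrable_bound)
      show "integrable Q (\<lambda>x. exp 1 + \<bar>Phi (exp (e * f x))\<bar>)"
        using int by auto
      show "AE x in Q. norm (exp (s * f x)) \<le> norm (exp 1 + \<bar>Phi (exp (e * f x))\<bar>)"
      proof (intro AE_I2)
        fix x
        show "norm (exp (s * f x)) \<le> norm (exp 1 + \<bar>Phi (exp (e * f x))\<bar>)"
        proof (cases "e * f x \<le> 1")
          case True
          then have "s * f x \<le> 1"
          proof (cases "f x \<ge> 0")
            case pos: True
            then have "s * f x \<le> e * f x" using assms(4) by (rule mult_right_mono[rotated])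
            with True show ?thesis by simp
          next
            case False
            then have "s * f x \<le> 0" using assms(3) by (simp add: mult_nonneg_nonpos)
            then show ?thesis by simp
          qed
          then have "exp (s * f x) \<le> exp 1" by (simp only: exp_le_cancel_iff)
          moreover have "norm (exp (s * f x)) = exp (s * f x)" by simp
          moreover have "norm (exp 1 + \<bar>Phi (exp (e * f x))\<bar>) = exp 1 + \<bar>Phi (exp (e * f x))\<bar>"
            by simp
          ultimately show ?thesis by linarith
        next
          case False
          then have pos: "f x \<ge> 0" using assms(3,4)
            by (smt (verit) mult_nonneg_nonpos)
          then have "s * f x \<le> e * f x" using assms(4) by (rule mult_right_mono[rotated])
          then have "exp (s * f x) \<le> exp (e * f x) * 1" by simp
          also have "\<dots> \<le> exp (e * f x) * (e * f x)"
            using False by (intro mult_left_mono) auto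
          also have "\<dots> \<le> \<bar>Phi (exp (e * f x))\<bar>" by (simp add: Phi_def)
          finally have "exp (s * f x) \<le> \<bar>Phi (exp (e * f x))\<bar>" .
          moreover have "norm (exp (s * f x)) = exp (s * f x)" by simp
          moreover have "norm (exp 1 + \<bar>Phi (exp (e * f x))\<bar>) = exp 1 + \<bar>Phi (exp (e * f x))\<bar>"
            by simp
          moreover have "0 \<le> exp (1::real)" by simp
          ultimately show ?thesis by linarith
        qed
      qed
    qed measurable
    with nint show False by simp
  qed
  then show ?thesis by (simp add: nEnt_def Ent_def)
qed

text \<open>For \<open>q > 0\<close> and \<open>f = ln v\<close> with \<open>v\<close> positive
  almost everywhere, this is \<open>q * I_ent\<close>, with the powers of \<open>v\<close> in
  exponential form.\<close>

definition entropy_integral :: "'a measure \<Rightarrow> ('a \<Rightarrow> real) \<Rightarrow> real \<Rightarrow> ennreal" where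
  "entropy_integral Q f q =
     (\<integral>\<^sup>+e\<in>{0<..<q}. e2ennreal (nEnt Q (\<lambda>x. exp (e * f x))) * ennreal (1 / e\<^sup>2) \<partial>lborel)"

text \<open>Were \<open>exp (s * f)\<close> not integrable, the normalized entropy would be infinite
  on all of \<open>{s<..<q}\<close>, an interval of positive length.\<close>

lemma entropy_integral_finite_imp_integrable:
  assumes Q: "prob_space Q" and f: "f \<in> borel_measurable Q"
    and s: "0 < s" "s < q" and fin: "entropy_integral Q f q < \<infinity>"
  shows "integrable Q (\<lambda>x. exp (s * f x))"
proof (rule ccontr)
  assume nint: "\<not> integrable Q (\<lambda>x. exp (s * f x))"
  have "\<infinity> = (\<integral>\<^sup>+e. \<infinity> * indicator {s<..<q} e \<partial>lborel)"
    using s by (subst nn_integral_cmult_indicator) (auto simp: ennreal_top_mult)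
  also have "\<dots> \<le> entropy_integral Q f q"
    unfolding entropy_integral_def
  proof (rule nn_integral_mono)
    fix e
    show "\<infinity> * indicator {s<..<q} e
      \<le> e2ennreal (nEnt Q (\<lambda>x. exp (e * f x))) * ennreal (1 / e\<^sup>2) * indicator {0<..<q} e"
    proof (cases "e \<in> {s<..<q}")
      case True
      then have "nEnt Q (\<lambda>x. exp (e * f x)) = \<infinity>"
        using s by (intro nEnt_eq_infinity[OF Q f _ _ nint]) auto
      then show ?thesis
        using True s by (simp add: ennreal_top_mult)
    qed simp
  qed
  finally show False using fin by simp
qed

text \<open>The fundamental theorem of calculus is applied to \<open>cumulant e / e\<close> on
  \<open>{a..s}\<close>, away from the division by zero at \<open>0\<close>. Then \<open>a\<close>
  tends to \<open>0\<close> from the right, where the quotient tends to the mean.\<close>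

lemma (in bounded_below_exp) cumulant_le_entropy_integral:
  assumes s: "0 < s" "s < b" "s \<le> q" and fin: "entropy_integral Q f q < \<infinity>"
  shows "cumulant s / s - expectation f \<le> enn2real (entropy_integral Q f q)"
proof -
  have le: "cumulant s / s - cumulant a / a \<le> enn2real (entropy_integral Q f q)" if a: "0 < a" "a < s" for a
  proof -
    have nn: "0 \<le> entropy_fun e / e\<^sup>2" if "e \<in> {a<..<s}" for e
      using nEnt_exp(2)[of e] that s by simp
    have "((\<lambda>e. entropy_fun e / e\<^sup>2) has_integral (cumulant s / s - cumulant a / a)) {a..s}"
      using a s by (intro fundamental_theorem_of_calculus)
        (auto simp flip: has_real_derivative_iff_has_vector_derivative
            intro!: has_field_derivative_at_within[OF cumulant_quotient_deriv])
    then have I: "((\<lambda>e. entropy_fun e / e\<^sup>2) has_integral (cumulant s / s - cumulant a / a)) {a<..<s}"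
      by (simp add: has_integral_Icc_iff_Ioo)
    then have nonneg: "0 \<le> cumulant s / s - cumulant a / a"
      using nn by (rule has_integral_nonneg)
    have "ennreal (cumulant s / s - cumulant a / a)
        = (\<integral>\<^sup>+e. ennreal (entropy_fun e / e\<^sup>2) * indicator {a<..<s} e \<partial>lborel)"
      using nn_integral_has_integral_lebesgue'[OF nn I] by simp
    also have "\<dots> \<le> entropy_integral Q f q"
      unfolding entropy_integral_def
    proof (rule nn_integral_mono)
      fix e
      show "ennreal (entropy_fun e / e\<^sup>2) * indicator {a<..<s} e
         \<le> e2ennreal (nEnt Q (\<lambda>x. exp (e * f x))) * ennreal (1 / e\<^sup>2) * indicator {0<..<q} e"
      proof (cases "e \<in> {a<..<s}")
        case True
        then show ?thesis
          using a s nEnt_exp[of e] by (simp add: divide_inverse flip: ennreal_mult')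
      qed simp
    qed
    finally have "enn2real (ennreal (cumulant s / s - cumulant a / a)) \<le> enn2real (entropy_integral Q f q)"
      using fin by (intro enn2real_mono) auto
    then show ?thesis using nonneg by simp
  qed
  have "((\<lambda>a. cumulant s / s - cumulant a / a) \<longlongrightarrow> cumulant s / s - expectation f) (at_right 0)"
    by (intro tendsto_intros cumulant_quotient_tendsto)
  moreover have "eventually (\<lambda>a. cumulant s / s - cumulant a / a \<le> enn2real (entropy_integral Q f q)) (at_right 0)"
    unfolding eventually_at_right_field using le s by blast
  ultimately show ?thesis
    by (rule tendsto_upperbound) simp
qed

text \<open>Integrating the derivative of \<open>s \<mapsto> ln (Q (exp (s * f))) / s\<close>, which is the normalized entropy
  of \<open>exp (s * f)\<close> divided by \<open>s\<^sup>2\<close>.\<close>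

lemma herbst:
  assumes Q: "prob_space Q" and f [measurable]: "f \<in> borel_measurable Q"
    and lower: "AE x in Q. c \<le> f x"
    and q: "0 < q" and fin: "entropy_integral Q f q < \<infinity>"
  shows "integrable Q (\<lambda>x. exp (q * f x))"
    and "ln (\<integral>x. exp (q * f x) \<partial>Q) \<le> q * ((\<integral>x. f x \<partial>Q) + enn2real (entropy_integral Q f q))"
proof -
  interpret prob_space Q by fact
  define B where "B = expectation f + enn2real (entropy_integral Q f q)"
  have bound: "(\<integral>\<^sup>+x. exp (s * f x) \<partial>Q) \<le> ennreal (exp (s * B))" if s: "0 < s" "s < q" for s
  proof -
    \<comment> \<open>The exponential moment at \<open>b\<close> is available only for
      \<open>b < q\<close>, and the calculus at \<open>s\<close> requires
      \<open>s < b\<close>.\<close>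
    define b where "b = (s + q) / 2"
    have b: "s < b" "b < q" using s by (auto simp: b_def)
    interpret bounded_below_exp Q f c b
      using s b lower entropy_integral_finite_imp_integrable[OF Q f _ b(2) fin]
      by unfold_locales auto
    have "cumulant s / s - expectation f \<le> enn2real (entropy_integral Q f q)"
      using s b fin by (intro cumulant_le_entropy_integral) auto
    then have "cumulant s \<le> s * B"
      using s by (simp add: B_def field_simps)
    then have "exp_moment Q f 0 s \<le> exp (s * B)"
      using exp_moment_0_pos[OF b(1)]
      unfolding cumulant_def by (metis exp_le_cancel_iff exp_ln)
    moreover have "(\<integral>\<^sup>+x. exp (s * f x) \<partial>Q) = ennreal (exp_moment Q f 0 s)"
      using moment_integrable[OF b(1), of 0] unfolding exp_moment_def
      by (subst nn_integral_eq_integral) auto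
    ultimately show ?thesis by (simp add: ennreal_leI)
  qed
  \<comment> \<open>Integrability at \<open>q\<close> itself is not known beforehand, so the bound
    is carried from \<open>\<sigma> n < q\<close> to \<open>q\<close> by Fatou's lemma. The shift
    \<open>n + 2\<close> keeps \<open>\<sigma> 0\<close> positive.\<close>
  define \<sigma> where "\<sigma> n = q * (1 - 1 / real (n + 2))" for n :: nat
  have \<sigma>: "0 < \<sigma> n" "\<sigma> n < q" for n
    using q by (auto simp: \<sigma>_def field_simps intro!: add_pos_nonneg)
  have \<sigma>_lim: "\<sigma> \<longlonglongrightarrow> q"
  proof -
    have "(\<lambda>n. q * (1 - 1 / real (n + 2))) \<longlonglongrightarrow> q * (1 - 0)"
      by (intro tendsto_intros LIMSEQ_ignore_initial_segment[OF lim_1_over_n])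
    then show ?thesis by (simp add: \<sigma>_def[abs_def])
  qed
  have "(\<integral>\<^sup>+x. ennreal (exp (q * f x)) \<partial>Q) = (\<integral>\<^sup>+x. liminf (\<lambda>n. ennreal (exp (\<sigma> n * f x))) \<partial>Q)"
  proof (intro nn_integral_cong)
    fix x
    have "(\<lambda>n. ennreal (exp (\<sigma> n * f x))) \<longlonglongrightarrow> ennreal (exp (q * f x))"
      by (intro tendsto_ennrealI tendsto_exp tendsto_mult \<sigma>_lim tendsto_const)
    from lim_imp_Liminf[OF _ this] show "ennreal (exp (q * f x)) = liminf (\<lambda>n. ennreal (exp (\<sigma> n * f x)))"
      by simp
  qed
  also have "\<dots> \<le> liminf (\<lambda>n. \<integral>\<^sup>+x. ennreal (exp (\<sigma> n * f x)) \<partial>Q)"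
    by (rule nn_integral_liminf) measurable
  also have "\<dots> \<le> liminf (\<lambda>n. ennreal (exp (\<sigma> n * B)))"
    by (intro Liminf_mono always_eventually allI bound \<sigma>)
  also have "\<dots> = ennreal (exp (q * B))"
    by (intro lim_imp_Liminf tendsto_ennrealI tendsto_exp tendsto_mult \<sigma>_lim tendsto_const) simp
  finally have le: "(\<integral>\<^sup>+x. ennreal (exp (q * f x)) \<partial>Q) \<le> ennreal (exp (q * B))" .
  then show int: "integrable Q (\<lambda>x. exp (q * f x))"
    by (intro integrableI_nonneg) (auto simp: le_less_trans)
  have "(\<integral>x. exp (q * f x) \<partial>Q) \<le> exp (q * B)"
    using le int by (simp add: nn_integral_eq_integral)
  moreover have "0 < (\<integral>x. exp (q * f x) \<partial>Q)"
    using int by (rule expectation_exp_pos)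
  ultimately have "ln (\<integral>x. exp (q * f x) \<partial>Q) \<le> ln (exp (q * B))"
    by (subst ln_le_cancel_iff) auto
  then show "ln (\<integral>x. exp (q * f x) \<partial>Q) \<le> q * (expectation f + enn2real (entropy_integral Q f q))"
    by (simp add: B_def)
qed

text \<open>With \<open>r\<close> the density of \<open>R\<close> and \<open>Z\<close> the mean of
  \<open>exp g\<close> under \<open>Q\<close>, let \<open>u\<close> be the ratio of the Gibbs
  density \<open>exp g / Z\<close> to \<open>r\<close>. Its \<open>R\<close>-integral is at most
  \<open>1\<close>, so integrating \<open>ln u \<le> u - 1\<close> against \<open>R\<close> gives
  the inequality.\<close>

lemma donsker_varadhan:
  assumes Q: "prob_space Q" and R: "prob_space R"
    and ac: "absolutely_continuous Q R" and sets_R: "sets R = sets Q"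
    and KL_int: "integrable R (entropy_density (exp 1) Q R)"
    and g_int: "integrable R g" and exp_int: "integrable Q (\<lambda>x. exp (g x))"
  shows "(\<integral>x. g x \<partial>R) \<le> KL_divergence (exp 1) Q R + ln (\<integral>x. exp (g x) \<partial>Q)"
proof -
  interpret Q: prob_space Q by fact
  interpret R: prob_space R by fact
  note [simp] = sets_R
  have [measurable_cong]: "sets R = sets Q" by fact
  define r where "r x = enn2real (RN_deriv Q R x)" for x
  have [measurable]: "g \<in> borel_measurable Q" "r \<in> borel_measurable Q"
    using borel_measurable_integrable[OF g_int] by (auto simp: r_def[abs_def] cong: measurable_cong_sets)
  have ed: "entropy_density (exp 1) Q R = (\<lambda>x. ln (r x))"
    by (auto simp: entropy_density_def r_def log_def)
  have r_nonneg: "r x \<ge> 0" for x by (simp add: r_def)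
  have r_pos: "AE x in R. 0 < r x"
  proof -
    obtain D where "AE x in Q. RN_deriv Q R x = ennreal (D x)" "AE x in R. 0 < D x" "\<And>x. 0 \<le> D x"
      using Q.real_RN_deriv[OF R.finite_measure_axioms ac sets_R] by metis
    moreover from this(1) have "AE x in R. RN_deriv Q R x = ennreal (D x)"
      by (rule absolutely_continuous_AE[OF sets_R ac])
    ultimately have "AE x in R. RN_deriv Q R x = ennreal (D x)" "AE x in R. 0 < D x" by auto
    then show ?thesis by eventually_elim (auto simp: r_def)
  qed
  define Z where "Z = (\<integral>x. exp (g x) \<partial>Q)"
  have Z: "Z > 0"
    unfolding Z_def using exp_int by (rule Q.expectation_exp_pos)
  define u where "u x = exp (g x) / (r x * Z)" for x
  have u_meas [measurable]: "u \<in> borel_measurable Q"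
    unfolding u_def by measurable
  \<comment> \<open>Equality holds where \<open>r x > 0\<close>; where \<open>r x = 0\<close>,
    division by zero gives \<open>u x = 0\<close>. Hence only the upper bound \<open>1\<close> for
    the \<open>R\<close>-integral of \<open>u\<close>.\<close>
  have ru: "r x * u x \<le> exp (g x) / Z" "0 \<le> r x * u x" for x
    using Z r_nonneg[of x] by (auto simp: u_def)
  have int_ru: "integrable Q (\<lambda>x. r x * u x)"
  proof (rule Bochner_Integration.integrable_bound)
    show "integrable Q (\<lambda>x. exp (g x) / Z)" using exp_int by simp
    show "AE x in Q. norm (r x * u x) \<le> norm (exp (g x) / Z)"
      using ru Z by (intro AE_I2) auto
  qed measurable
  have int_u: "integrable R u"
    using int_ru Q.RN_deriv_integrable[OF R.sigma_finite_measure_axioms ac sets_R u_meas]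
    by (simp add: r_def)
  have "(\<integral>x. u x \<partial>R) = (\<integral>x. r x * u x \<partial>Q)"
    using Q.RN_deriv_integral[OF R.sigma_finite_measure_axioms ac sets_R u_meas] by (simp add: r_def)
  also have "\<dots> \<le> (\<integral>x. exp (g x) / Z \<partial>Q)"
    using int_ru exp_int ru by (intro integral_mono) auto
  also have "\<dots> = 1"
    using Z by (simp flip: Z_def)
  finally have u_le: "(\<integral>x. u x \<partial>R) \<le> 1" .
  have "(\<integral>x. g x - ln (r x) - ln Z \<partial>R) \<le> (\<integral>x. u x - 1 \<partial>R)"
  proof (rule integral_mono_AE)
    show "AE x in R. g x - ln (r x) - ln Z \<le> u x - 1"
      using r_pos
    proof eventually_elim
      case (elim x)
      then have "0 < u x" using Z by (simp add: u_def)
      then have "ln (u x) \<le> u x - 1" by (rule ln_le_minus_one)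
      moreover have "ln (u x) = g x - ln (r x) - ln Z"
        using elim Z by (simp add: u_def ln_div ln_mult)
      ultimately show ?case by simp
    qed
  qed (use g_int KL_int int_u in \<open>auto simp: ed\<close>)
  also have "\<dots> \<le> 0"
    using u_le int_u by (simp add: R.prob_space)
  finally have "(\<integral>x. g x \<partial>R) - (\<integral>x. ln (r x) \<partial>R) - ln Z \<le> 0"
    using g_int KL_int by (simp add: ed R.prob_space)
  then show ?thesis
    by (simp add: KL_divergence_def ed Z_def)
qed

section \<open>The bound at one point and the small-\<open>q\<close> limit of
  \<open>I_ent\<close>\<close>

lemma nEnt_cong_AE:
  assumes [measurable]: "f \<in> borel_measurable Q" "g \<in> borel_measurable Q" and eq: "AE x in Q. f x = g x"
  shows "nEnt Q f = nEnt Q g"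
proof -
  have [measurable]: "Phi \<in> borel_measurable borel"
    unfolding Phi_def[abs_def] by measurable
  have "AE x in Q. Phi (f x) = Phi (g x)" using eq by auto
  then have "integrable Q (\<lambda>x. Phi (f x)) = integrable Q (\<lambda>x. Phi (g x))"
    "(\<integral>x. Phi (f x) \<partial>Q) = (\<integral>x. Phi (g x) \<partial>Q)"
    by (intro integrable_cong_AE integral_cong_AE; measurable)+
  moreover have "(\<integral>x. f x \<partial>Q) = (\<integral>x. g x \<partial>Q)"
    using eq by (intro integral_cong_AE) auto
  ultimately show ?thesis by (simp add: nEnt_def Ent_def)
qed

lemma I_ent_eq_entropy_integral:
  assumes [measurable]: "v \<in> borel_measurable (P x)" and pos: "AE y in P x. 0 < v y"
  shows "I_ent P v q x = ennreal (1 / q) * entropy_integral (P x) (\<lambda>y. ln (v y)) q"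
proof -
  have "nEnt (P x) (\<lambda>y. v y powr e) = nEnt (P x) (\<lambda>y. exp (e * ln (v y)))" for e
    using pos by (intro nEnt_cong_AE) (auto simp: powr_def)
  then show ?thesis by (simp add: I_ent_def entropy_integral_def)
qed

text \<open>Donsker-Varadhan is applied to \<open>q * ln v\<close>, Herbst's bound replaces the
  log-Laplace transform, and the result is divided by \<open>q\<close>. Truncating the left side at
  \<open>0\<close> is harmless, the right side being nonnegative.\<close>

lemma log_difference_le:
  assumes Q: "prob_space (P x)" and R: "prob_space R"
    and ac: "absolutely_continuous (P x) R" and sets_R: "sets R = sets (P x)"
    and v [measurable]: "v \<in> borel_measurable (P x)"
    and c: "0 < c" and lower: "AE y in P x. c \<le> v y"
    and int: "integrable R (\<lambda>y. ln (v y))" and q: "0 < q"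
  shows "ennreal ((\<integral>y. ln (v y) \<partial>R) - (\<integral>y. ln (v y) \<partial>P x))
    \<le> ennreal (1 / q) * KL R (P x) + ennreal q * I_ent P v q x"
proof -
  let ?f = "\<lambda>y. ln (v y)" and ?Q = "P x"
  let ?J = "entropy_integral ?Q ?f q"
  have pos: "AE y in ?Q. 0 < v y" using lower c by auto
  have J: "ennreal q * I_ent P v q x = ?J"
    using q by (simp add: I_ent_eq_entropy_integral[of v P x, OF v pos] flip: mult.assoc ennreal_mult')
  show ?thesis
  proof (cases "KL R ?Q = \<infinity> \<or> ?J = \<infinity>")
    \<comment> \<open>As \<open>1 / q > 0\<close>, either infinite term makes the right side
      infinite.\<close>
    case True
    then show ?thesis unfolding J using q by (auto simp: ennreal_mult_top)
  next
    case False
    then have KL: "integrable R (entropy_density (exp 1) ?Q R)"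
      "KL R ?Q = ennreal (KL_divergence (exp 1) ?Q R)"
      by (auto simp: KL_def split: if_splits)
    have fin: "?J < \<infinity>" using False by (simp add: less_top)
    have lower': "AE y in ?Q. ln c \<le> ?f y"
      using lower c by auto
    have f: "?f \<in> borel_measurable ?Q" by measurable
    note herbst = herbst[OF Q f lower' q fin]
    have "(\<integral>y. q * ?f y \<partial>R) \<le> KL_divergence (exp 1) ?Q R + ln (\<integral>y. exp (q * ?f y) \<partial>?Q)"
      using int herbst(1) by (intro donsker_varadhan[OF Q R ac sets_R KL(1)]) auto
    also note herbst(2)
    finally have "q * (\<integral>y. ?f y \<partial>R) \<le> KL_divergence (exp 1) ?Q R + q * ((\<integral>y. ?f y \<partial>?Q) + enn2real ?J)"
      by simp
    then have "(\<integral>y. ?f y \<partial>R) - (\<integral>y. ?f y \<partial>?Q) \<le> 1 / q * KL_divergence (exp 1) ?Q R + enn2real ?J"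
      using q by (simp add: field_simps)
    then have "ennreal ((\<integral>y. ?f y \<partial>R) - (\<integral>y. ?f y \<partial>?Q)) \<le>
        ennreal (1 / q * KL_divergence (exp 1) ?Q R + enn2real ?J)"
      by (rule ennreal_leI)
    \<comment> \<open>\<open>ennreal\<close> truncates negative reals to \<open>0\<close> and is
      therefore subadditive.\<close>
    also have "\<dots> \<le> ennreal (1 / q * KL_divergence (exp 1) ?Q R) + ennreal (enn2real ?J)"
      by (auto simp: ennreal_plus_if intro: ennreal_leI)
    also have "\<dots> = ennreal (1 / q) * KL R ?Q + ?J"
      unfolding KL(2) using q fin by (subst ennreal_mult') (auto simp: less_top)
    finally show ?thesis unfolding J .
  qed
qed

text \<open>For small \<open>q\<close>, \<open>I_ent\<close> is the average over
  \<open>{0<..<q}\<close> of the normalized entropy divided by \<open>e\<^sup>2\<close>. That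
  integrand tends to half the variance, and so do its averages.\<close>

lemma I_ent_tendsto_variance:
  assumes Q: "prob_space (P x)" and v: "integrable (P x) v"
    and c: "0 < c" and lower: "AE y in P x. c \<le> v y"
  shows "((\<lambda>q. I_ent P v q x) \<longlongrightarrow> ennreal (prob_space.variance (P x) (\<lambda>y. ln (v y)) / 2)) (at_right 0)"
proof -
  have [measurable]: "v \<in> borel_measurable (P x)" using v by simp
  have pos: "AE y in P x. 0 < v y" using lower c by auto
  let ?f = "\<lambda>y. ln (v y)"
  \<comment> \<open>The exponent \<open>1\<close> is the available one:
    \<open>exp (1 * ln v)\<close> is \<open>v\<close> almost everywhere, which is
    integrable.\<close>
  interpret bounded_below_exp "P x" ?f "ln c" 1
  proof (intro bounded_below_exp.intro Q bounded_below_exp_axioms.intro)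
    show "AE y in P x. ln c \<le> ?f y" using lower c by auto
    have "integrable (P x) v \<longleftrightarrow> integrable (P x) (\<lambda>y. exp (1 * ?f y))"
      using pos by (intro integrable_cong_AE) auto
    then show "integrable (P x) (\<lambda>y. exp (1 * ?f y))" using v by simp
  qed auto
  define L where "L = variance ?f / 2"
  define h where "h e = entropy_fun e / e\<^sup>2" for e
  have L: "L \<ge> 0" by (simp add: L_def)
  have h_nonneg: "0 \<le> h e" if "e < 1" for e
    using nEnt_exp(2)[OF that] by (simp add: h_def)
  have h_lim: "(h \<longlongrightarrow> L) (at_right 0)"
    using entropy_fun_tendsto unfolding h_def[abs_def] L_def .
  have I: "I_ent P v q x = ennreal (1 / q) * (\<integral>\<^sup>+e. ennreal (h e) * indicator {0<..<q} e \<partial>lborel)"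
    if "q < 1" for q
    unfolding I_ent_eq_entropy_integral[of v P x, OF \<open>v \<in> _\<close> pos] entropy_integral_def
  proof (rule arg_cong[where f="\<lambda>z. ennreal (1 / q) * z"], rule nn_integral_cong)
    fix e
    show "e2ennreal (nEnt (P x) (\<lambda>y. exp (e * ?f y))) * ennreal (1 / e\<^sup>2) * indicator {0<..<q} e
      = ennreal (h e) * indicator {0<..<q} e"
    proof (cases "e \<in> {0<..<q}")
      case True
      then show ?thesis
        using that nEnt_exp[of e] by (simp add: h_def divide_inverse flip: ennreal_mult')
    qed simp
  qed
  have const: "ennreal (1 / q) * (\<integral>\<^sup>+e. ennreal a * indicator {0<..<q} e \<partial>lborel) = ennreal a"
    if "0 < q" for a q :: real
    using that by (subst nn_integral_cmult_indicator)
      (auto simp: mult.left_commute simp flip: ennreal_mult')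
  \<comment> \<open>If the integrand stays within \<open>d\<close> of \<open>L\<close>, so does its
    average. When \<open>d > L\<close> the lower bound is \<open>ennreal (L - d) = 0\<close>, which
    is trivially valid.\<close>
  have close: "ennreal (L - d) \<le> I_ent P v q x \<and> I_ent P v q x \<le> ennreal (L + d)"
    if d: "0 < q" "q < 1" "\<And>e. 0 < e \<Longrightarrow> e < q \<Longrightarrow> \<bar>h e - L\<bar> \<le> d" for d q
  proof
    have "ennreal (1 / q) * (\<integral>\<^sup>+e. ennreal (L - d) * indicator {0<..<q} e \<partial>lborel) \<le> I_ent P v q x"
      unfolding I[OF d(2)] using d(3)
      by (intro mult_left_mono nn_integral_mono) (force intro!: ennreal_leI split: split_indicator)+
    then show "ennreal (L - d) \<le> I_ent P v q x" by (simp only: const[OF d(1)])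
    have "I_ent P v q x \<le> ennreal (1 / q) * (\<integral>\<^sup>+e. ennreal (L + d) * indicator {0<..<q} e \<partial>lborel)"
      unfolding I[OF d(2)] using d(3)
      by (intro mult_left_mono nn_integral_mono) (force intro!: ennreal_leI split: split_indicator)+
    then show "I_ent P v q x \<le> ennreal (L + d)" by (simp only: const[OF d(1)])
  qed
  have ev: "eventually (\<lambda>q. ennreal (L - d) \<le> I_ent P v q x \<and> I_ent P v q x \<le> ennreal (L + d)) (at_right 0)"
    if d: "0 < d" for d
  proof -
    have "eventually (\<lambda>e. \<bar>h e - L\<bar> < d) (at_right 0)"
      using tendstoD[OF h_lim d] by (simp add: dist_real_def)
    then obtain q0 where q0: "q0 > 0" "\<And>e. 0 < e \<Longrightarrow> e < q0 \<Longrightarrow> \<bar>h e - L\<bar> < d"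
      unfolding eventually_at_right_field by auto
    show ?thesis
      unfolding eventually_at_right_field
    proof (intro exI[of _ "min q0 1"] conjI allI impI)
      show "min q0 1 > 0" using q0 by simp
      fix q :: real assume "0 < q" "q < min q0 1"
      then have "ennreal (L - d) \<le> I_ent P v q x \<and> I_ent P v q x \<le> ennreal (L + d)"
        using q0(2) by (intro close) (auto intro: less_imp_le)
      then show "ennreal (L - d) \<le> I_ent P v q x" "I_ent P v q x \<le> ennreal (L + d)" by auto
    qed
  qed
  \<comment> \<open>Convergence is checked in the metric of the reals and transported back,
    \<open>I_ent\<close> being finite for small \<open>q\<close>. Using \<open>d / 2\<close> in the
    squeeze yields the strict bound by \<open>d\<close>.\<close>
  have "((\<lambda>q. ennreal (enn2real (I_ent P v q x))) \<longlongrightarrow> ennreal L) (at_right 0)"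
  proof (intro tendsto_ennrealI tendstoI)
    fix d :: real assume "d > 0"
    then have "eventually (\<lambda>q. ennreal (L - d / 2) \<le> I_ent P v q x \<and> I_ent P v q x \<le> ennreal (L + d / 2)) (at_right 0)"
      by (intro ev) simp
    then show "eventually (\<lambda>q. dist (enn2real (I_ent P v q x)) L < d) (at_right 0)"
    proof eventually_elim
      case (elim q)
      then have "I_ent P v q x < \<infinity>" by (auto simp: le_less_trans)
      with elim \<open>d > 0\<close> L show ?case
        by (cases "I_ent P v q x")
           (auto simp: dist_real_def ennreal_le_iff2 abs_if simp flip: ennreal_plus)
    qed
  qed
  moreover have "eventually (\<lambda>q. ennreal (enn2real (I_ent P v q x)) = I_ent P v q x) (at_right 0)"
    using ev[of 1] by (rule eventually_mono) (auto simp: le_less_trans)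
  ultimately show ?thesis
    unfolding L_def by (rule Lim_transform_eventually)
qed

subsection \<open>Densities and kernels\<close>

lemma borel_measurable_dens [measurable]: "dens \<pi> \<mu> \<in> borel_measurable \<pi>"
  unfolding dens_def[abs_def] by measurable

lemma dens_nonneg: "0 \<le> dens \<pi> \<mu> x"
  by (simp add: dens_def)

text \<open>Sigma-finiteness of \<open>\<mu>\<close> makes the Radon-Nikodym derivative finite
  almost everywhere, so passing to real values alters it only on a null set.\<close>

lemma density_dens:
  assumes "sigma_finite_measure \<pi>" "sigma_finite_measure \<mu>"
    and ac: "absolutely_continuous \<pi> \<mu>" "sets \<mu> = sets \<pi>"
  shows "density \<pi> (\<lambda>x. ennreal (dens \<pi> \<mu> x)) = \<mu>"
proof -
  interpret sigma_finite_measure \<pi> by fact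
  have "density \<pi> (\<lambda>x. ennreal (dens \<pi> \<mu> x)) = density \<pi> (RN_deriv \<pi> \<mu>)"
    using RN_deriv_finite[OF assms(2-4)]
    by (intro density_cong) (auto simp: dens_def less_top)
  then show ?thesis by (simp add: density_RN_deriv[OF ac])
qed

lemma
  assumes "prob_space \<pi>" "prob_space \<mu>"
    and ac: "absolutely_continuous \<pi> \<mu>" "sets \<mu> = sets \<pi>"
  shows nn_integral_dens: "f \<in> borel_measurable \<pi> \<Longrightarrow> (\<integral>\<^sup>+x. f x \<partial>\<mu>) = (\<integral>\<^sup>+x. ennreal (dens \<pi> \<mu> x) * f x \<partial>\<pi>)"
    and integrable_dens: "integrable \<pi> (dens \<pi> \<mu>)"
proof -
  interpret \<pi>: prob_space \<pi> by fact
  interpret \<mu>: prob_space \<mu> by fact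
  have dens: "density \<pi> (\<lambda>x. ennreal (dens \<pi> \<mu> x)) = \<mu>"
    using ac by (intro density_dens) unfold_locales
  show nn: "(\<integral>\<^sup>+x. f x \<partial>\<mu>) = (\<integral>\<^sup>+x. ennreal (dens \<pi> \<mu> x) * f x \<partial>\<pi>)" if "f \<in> borel_measurable \<pi>" for f
    using that by (subst dens[symmetric], subst nn_integral_density) auto
  show "integrable \<pi> (dens \<pi> \<mu>)"
    using nn[of "\<lambda>_. 1"] by (intro integrableI_nonneg) (auto simp: dens_nonneg \<mu>.emeasure_space_1)
qed

text \<open>The comparison of measures is tested on the set \<open>A\<close> where the claim fails:
  there \<open>a * c - dens \<pi> \<nu>\<close> is positive, yet its integral over \<open>A\<close>
  is at most \<open>0\<close>, so \<open>A\<close> is null.\<close>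

lemma AE_dens_ge:
  assumes "prob_space \<pi>" "prob_space \<mu>" "prob_space \<nu>"
    and ac: "absolutely_continuous \<pi> \<mu>" "sets \<mu> = sets \<pi>" "absolutely_continuous \<pi> \<nu>" "sets \<nu> = sets \<pi>"
    and a: "0 \<le> a" and le: "\<And>A. A \<in> sets \<pi> \<Longrightarrow> a * measure \<mu> A \<le> measure \<nu> A"
    and lower: "AE x in \<pi>. c \<le> dens \<pi> \<mu> x"
  shows "AE x in \<pi>. a * c \<le> dens \<pi> \<nu> x"
proof -
  interpret \<pi>: prob_space \<pi> by fact
  interpret \<mu>: prob_space \<mu> by fact
  interpret \<nu>: prob_space \<nu> by fact
  define A where "A = {x \<in> space \<pi>. dens \<pi> \<nu> x < a * c}"
  have [measurable]: "A \<in> sets \<pi>" unfolding A_def by measurable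
  note int = integrable_dens[OF assms(1,2) ac(1,2)] integrable_dens[OF assms(1,3) ac(3,4)]
  have m: "measure \<mu> A = (\<integral>x. dens \<pi> \<mu> x * indicator A x \<partial>\<pi>)"
    "measure \<nu> A = (\<integral>x. dens \<pi> \<nu> x * indicator A x \<partial>\<pi>)"
    using \<pi>.RN_deriv_integral[OF \<mu>.sigma_finite_measure_axioms ac(1,2), of "indicator A"]
      \<pi>.RN_deriv_integral[OF \<nu>.sigma_finite_measure_axioms ac(3,4), of "indicator A"] ac
    by (auto simp: dens_def sets_eq_imp_space_eq[OF ac(2)] sets_eq_imp_space_eq[OF ac(4)] Int_absorb2 sets.sets_into_space)
  note intA = integrable_mult_indicator[OF \<open>A \<in> sets \<pi>\<close> int(1)] integrable_mult_indicator[OF \<open>A \<in> sets \<pi>\<close> int(2)]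
    integrable_mult_indicator[OF \<open>A \<in> sets \<pi>\<close>, of "\<lambda>_. a * c :: real"]
  have "(\<integral>x. a * c * indicator A x \<partial>\<pi>) \<le> (\<integral>x. a * (dens \<pi> \<mu> x * indicator A x) \<partial>\<pi>)"
  proof (rule integral_mono_AE)
    show "AE x in \<pi>. a * c * indicator A x \<le> a * (dens \<pi> \<mu> x * indicator A x)"
      using lower by eventually_elim (auto simp: indicator_def a mult_left_mono)
  qed (use intA in \<open>auto simp: mult.commute\<close>)
  also have "\<dots> = a * measure \<mu> A" by (simp add: m)
  also have "\<dots> \<le> measure \<nu> A" by (rule le) simp
  finally have "(\<integral>x. a * c * indicator A x - dens \<pi> \<nu> x * indicator A x \<partial>\<pi>) \<le> 0"
    unfolding m using intA by (subst Bochner_Integration.integral_diff) (auto simp: mult.commute)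
  moreover have nonneg: "0 \<le> a * c * indicator A x - dens \<pi> \<nu> x * indicator A x" for x
    by (auto simp: A_def indicator_def)
  ultimately have "(\<integral>x. a * c * indicator A x - dens \<pi> \<nu> x * indicator A x \<partial>\<pi>) = 0"
    by (intro antisym integral_nonneg_AE) auto
  then have "AE x in \<pi>. a * c * indicator A x - dens \<pi> \<nu> x * indicator A x = 0"
    using intA nonneg
    by (subst (asm) integral_nonneg_eq_0_iff_AE) (auto simp: mult.commute)
  then show ?thesis
    using AE_space by eventually_elim (auto simp: A_def indicator_def split: if_splits)
qed

section \<open>Integrability under kernels and the bound on \<open>Delta\<close>\<close>

lemma ennreal_integral_le_nn_integral:
  assumes "integrable M f"
  shows "ennreal (\<integral>x. f x \<partial>M) \<le> (\<integral>\<^sup>+x. ennreal (f x) \<partial>M)"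
proof -
  have "ennreal (\<integral>x. f x \<partial>M) \<le> ennreal (\<integral>x. max 0 (f x) \<partial>M)"
    using assms by (intro ennreal_leI integral_mono) auto
  also have "\<dots> = (\<integral>\<^sup>+x. ennreal (max 0 (f x)) \<partial>M)"
    using assms by (intro nn_integral_eq_integral[symmetric]) auto
  also have "\<dots> = (\<integral>\<^sup>+x. ennreal (f x) \<partial>M)"
    by (intro nn_integral_cong) (auto simp: max_def ennreal_neg)
  finally show ?thesis .
qed

text \<open>Young's inequality for \<open>w * ln w - w\<close> and its convex conjugate
  \<open>exp\<close>, evaluated at \<open>ln v\<close>, with the term \<open>- w\<close>
  dropped.\<close>

lemma mult_ln_le:
  fixes w v :: real
  assumes "0 \<le> w" "0 < v"
  shows "w * ln v \<le> Phi w + v"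
proof (cases "w = 0")
  case False
  then have w: "w > 0" using assms by simp
  have "w * ln (v / w) \<le> w * (v / w - 1)"
    using w assms by (intro mult_left_mono ln_le_minus_one) auto
  then show ?thesis
    using w assms by (simp add: ln_div Phi_def algebra_simps)
qed (use assms in \<open>simp add: Phi_def\<close>)

text \<open>The integral against \<open>\<mu> \<bind> K\<close> is an iterated one, and a finite
  outer integral forces the inner one to be finite almost everywhere.\<close>

lemma AE_integrable_kernel:
  assumes K [measurable]: "K \<in> borel \<rightarrow>\<^sub>M prob_algebra borel"
    and \<mu>: "sets \<mu> = sets borel"
    and [measurable]: "f \<in> borel_measurable borel"
    and fin: "(\<integral>\<^sup>+x. ennreal \<bar>f x\<bar> \<partial>(\<mu> \<bind> K)) < \<infinity>"
  shows "AE x in \<mu>. integrable (K x) (f :: 'a::topological_space \<Rightarrow> real)"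
proof -
  note [measurable_cong] = \<mu>
  have K' [measurable]: "K \<in> \<mu> \<rightarrow>\<^sub>M subprob_algebra borel"
    using measurable_prob_algebraD[OF K] by measurable
  have "(\<integral>\<^sup>+x. ennreal \<bar>f x\<bar> \<partial>(\<mu> \<bind> K)) = (\<integral>\<^sup>+x. \<integral>\<^sup>+y. ennreal \<bar>f y\<bar> \<partial>K x \<partial>\<mu>)"
    by (rule nn_integral_bind[OF _ K']) measurable
  then have "AE x in \<mu>. (\<integral>\<^sup>+y. ennreal \<bar>f y\<bar> \<partial>K x) \<noteq> \<infinity>"
    using fin by (intro nn_integral_PInf_AE) (auto simp: less_top)
  then show ?thesis
    using AE_space
  proof eventually_elim
    case (elim x)
    then have "sets (K x) = sets borel"
      using K' by (metis sets_kernel)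
    then have "f \<in> borel_measurable (K x)"
      by (simp cong: measurable_cong_sets)
    with elim(1) show ?case
      by (intro integrableI_bounded) (auto simp: less_top)
  qed
qed

text \<open>The analytic core for one fixed law: the jump process enters only through absolute
  continuity, the lower bound \<open>c\<close> and the integrability of \<open>Phi\<close> of the
  dual density.\<close>

lemma Delta_le_and_I_ent_tendsto:
  fixes \<pi> \<rho> :: "'a::topological_space measure"
  defines "v \<equiv> dens \<pi> \<rho>"
  assumes \<pi>: "\<pi> \<in> space (prob_algebra borel)" and \<rho>: "\<rho> \<in> space (prob_algebra borel)"
    and P [measurable]: "P \<in> borel \<rightarrow>\<^sub>M prob_algebra borel"
    and K [measurable]: "K \<in> borel \<rightarrow>\<^sub>M prob_algebra borel"
    and inv: "\<pi> \<bind> P = \<pi>"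
    and ac: "absolutely_continuous \<pi> \<rho>" and acK: "absolutely_continuous \<pi> (\<rho> \<bind> K)"
    and KP: "\<And>x. absolutely_continuous (P x) (K x)"
    and c: "0 < c" and lower: "AE x in \<pi>. c \<le> v x"
    and Phi_int: "integrable \<pi> (\<lambda>x. Phi (dual_op \<pi> K v x))"
  shows "ereal (Delta \<pi> P K v) \<le> enn2ereal (\<integral>\<^sup>+x. (INF q\<in>{0<..}. ennreal (1 / q) * KL (K x) (P x)
            + ennreal q * I_ent P v q x) \<partial>\<rho>)"
    and "AE x in \<rho>. ((\<lambda>q. I_ent P v q x) \<longlongrightarrow>
            ennreal (prob_space.variance (P x) (\<lambda>y. ln (v y)) / 2)) (at_right 0)"
proof -
  have sets: "sets \<pi> = sets borel" "sets \<rho> = sets borel" "sets \<rho> = sets \<pi>"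
    and prob: "prob_space \<pi>" "prob_space \<rho>"
    using \<pi> \<rho> by (auto simp: space_prob_algebra)
  note [measurable_cong] = sets(1,2)
  interpret \<pi>: prob_space \<pi> by fact
  interpret \<rho>: prob_space \<rho> by fact
  have kernel: "prob_space (L x)" "sets (L x) = sets borel" if "L \<in> borel \<rightarrow>\<^sub>M prob_algebra borel" for L :: "'a \<Rightarrow> 'a measure" and x
    using measurable_space[OF that, of x] by (auto simp: space_prob_algebra)
  have bind: "\<rho> \<bind> K \<in> space (prob_algebra borel)"
    using measurable_space[OF measurable_bind_prob_space[OF measurable_const[OF \<rho>] K], of _ borel]
    by simp
  then have probK: "prob_space (\<rho> \<bind> K)" and setsK: "sets (\<rho> \<bind> K) = sets \<pi>"
    by (auto simp: space_prob_algebra sets)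
  have v [measurable]: "v \<in> borel_measurable borel"
    using borel_measurable_dens[of \<pi> \<rho>] by (simp add: v_def sets cong: measurable_cong_sets)
  have v_int: "integrable \<pi> v"
    unfolding v_def by (intro integrable_dens prob ac sets)
  have v_nonneg: "0 \<le> v x" for x by (simp add: v_def dens_nonneg)
  have density_v: "density \<pi> (\<lambda>x. ennreal (v x)) = \<rho>"
    unfolding v_def by (intro density_dens ac sets) unfold_locales
  define w where "w = dens \<pi> (\<rho> \<bind> K)"
  \<comment> \<open>As \<open>v\<close> is the density of \<open>\<rho>\<close>, the hypothesis on
    \<open>dual_op\<close> becomes integrability of \<open>Phi w\<close>.\<close>
  have dual: "dual_op \<pi> K v = w"
    by (simp add: dual_op_def density_v w_def)
  have [measurable]: "w \<in> borel_measurable borel"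
    using borel_measurable_dens[of \<pi> "\<rho> \<bind> K"] by (simp add: w_def sets cong: measurable_cong_sets)
  have w_int: "integrable \<pi> w"
    unfolding w_def by (intro integrable_dens prob probK acK setsK)
  have w_nonneg: "0 \<le> w x" for x by (simp add: w_def dens_nonneg)
  note Phi_int = Phi_int[unfolded dual]

  have wln_int: "integrable \<pi> (\<lambda>x. w x * \<bar>ln (v x)\<bar>)"
  proof (rule Bochner_Integration.integrable_bound)
    \<comment> \<open>The majorant combines
      \<open>\<bar>ln v\<bar> \<le> ln v + 2 * \<bar>ln c\<bar>\<close>, which follows from
      \<open>ln c \<le> ln v\<close>, with Young's inequality for \<open>w * ln v\<close>.\<close>
    show "integrable \<pi> (\<lambda>x. Phi (w x) + v x + 2 * \<bar>ln c\<bar> * w x)"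
      using Phi_int v_int w_int by auto
    show "AE x in \<pi>. norm (w x * \<bar>ln (v x)\<bar>) \<le> norm (Phi (w x) + v x + 2 * \<bar>ln c\<bar> * w x)"
      using lower
    proof eventually_elim
      case (elim x)
      then have "ln c \<le> ln (v x)" and pos: "0 < v x" using c by auto
      then have "\<bar>ln (v x)\<bar> \<le> ln (v x) + 2 * \<bar>ln c\<bar>" by linarith
      then have "w x * \<bar>ln (v x)\<bar> \<le> w x * (ln (v x) + 2 * \<bar>ln c\<bar>)"
        by (intro mult_left_mono w_nonneg)
      also have "\<dots> \<le> Phi (w x) + v x + 2 * \<bar>ln c\<bar> * w x"
        using mult_ln_le[OF w_nonneg[of x] pos] by (simp add: algebra_simps)
      finally show ?case using w_nonneg[of x] by (simp add: abs_mult)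
    qed
  qed measurable
  have "(\<integral>\<^sup>+x. ennreal \<bar>ln (v x)\<bar> \<partial>(\<rho> \<bind> K)) = (\<integral>\<^sup>+x. ennreal (w x * \<bar>ln (v x)\<bar>) \<partial>\<pi>)"
    by (subst nn_integral_dens[OF prob(1) probK acK setsK])
       (auto simp: w_def dens_nonneg ennreal_mult)
  also have "\<dots> < \<infinity>"
    using wln_int w_nonneg by (subst nn_integral_eq_integral) auto
  finally have intK: "AE x in \<rho>. integrable (K x) (\<lambda>y. ln (v y))"
    by (intro AE_integrable_kernel[OF K sets(2)]) auto
  have P': "P \<in> \<pi> \<rightarrow>\<^sub>M subprob_algebra borel"
    using measurable_prob_algebraD[OF P] by measurable
  have "(\<integral>\<^sup>+x. ennreal \<bar>v x\<bar> \<partial>(\<pi> \<bind> P)) < \<infinity>"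
    unfolding inv using v_int v_nonneg by (subst nn_integral_eq_integral) auto
  then have "AE x in \<pi>. integrable (P x) v"
    by (intro AE_integrable_kernel[OF P sets(1)]) auto
  then have intP: "AE x in \<rho>. integrable (P x) v"
    by (rule absolutely_continuous_AE[OF sets(3) ac])
  have "AE x in \<pi>. AE y in P x. c \<le> v y"
    using lower AE_bind[OF P', of "\<lambda>y. c \<le> v y", unfolded inv] by simp
  then have lowerP: "AE x in \<rho>. AE y in P x. c \<le> v y"
    by (rule absolutely_continuous_AE[OF sets(3) ac])

  show "AE x in \<rho>. ((\<lambda>q. I_ent P v q x) \<longlongrightarrow>
            ennreal (prob_space.variance (P x) (\<lambda>y. ln (v y)) / 2)) (at_right 0)"
    using intP lowerP by eventually_elim (rule I_ent_tendsto_variance[OF kernel(1)[OF P] _ c])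

  let ?G = "\<lambda>x. INF q\<in>{0<..}. ennreal (1 / q) * KL (K x) (P x) + ennreal q * I_ent P v q x"
  define g where "g x = kernel_op K (\<lambda>y. ln (v y)) x - kernel_op P (\<lambda>y. ln (v y)) x" for x
  \<comment> \<open>The exceptional null set does not depend on \<open>q\<close>, so the infimum
    over \<open>q\<close> may be taken at each remaining \<open>x\<close>.\<close>
  have g_le: "AE x in \<rho>. ennreal (g x) \<le> ?G x"
    using intK lowerP
  proof eventually_elim
    case (elim x)
    show ?case
    proof (rule INF_greatest)
      fix q :: real assume "q \<in> {0<..}"
      then show "ennreal (g x) \<le> ennreal (1 / q) * KL (K x) (P x) + ennreal q * I_ent P v q x"
        unfolding g_def kernel_op_def using elim c
        by (intro log_difference_le kernel KP)
           (auto simp: kernel[OF P] kernel[OF K] cong: measurable_cong_sets)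
    qed
  qed
  have "ennreal (Delta \<pi> P K v) \<le> (\<integral>\<^sup>+x. ?G x \<partial>\<rho>)"
  proof (cases "integrable \<pi> (\<lambda>x. v x * g x)")
    \<comment> \<open>The Bochner integral of a non-integrable function is \<open>0\<close> by
      convention, so the bound is immediate.\<close>
    case False
    then have "Delta \<pi> P K v = 0"
      by (simp add: Delta_def g_def not_integrable_integral_eq)
    then show ?thesis by simp
  next
    case True
    have [measurable]: "(\<lambda>x. v x * g x) \<in> borel_measurable \<pi>" using True by simp
    txt \<open>Measurability of \<open>g\<close> is recovered from that of \<open>v * g\<close> by dividing by \<open>v\<close>.\<close>
    define g' where "g' x = v x * g x / v x" for x
    have [measurable]: "g' \<in> borel_measurable \<pi>" unfolding g'_def[abs_def] by measurable
    have g'_eq: "AE x in \<pi>. g' x = g x"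
      using lower c by (auto simp: g'_def)
    then have g'_eq\<rho>: "AE x in \<rho>. g' x = g x"
      by (rule absolutely_continuous_AE[OF sets(3) ac])
    have "ennreal (Delta \<pi> P K v) = ennreal (\<integral>x. v x * g x \<partial>\<pi>)"
      by (simp add: Delta_def g_def)
    also have "\<dots> \<le> (\<integral>\<^sup>+x. ennreal (v x * g x) \<partial>\<pi>)"
      using True by (rule ennreal_integral_le_nn_integral)
    also have "\<dots> = (\<integral>\<^sup>+x. ennreal (v x) * ennreal (g' x) \<partial>\<pi>)"
      using g'_eq by (intro nn_integral_cong_AE) (auto simp: ennreal_mult' v_nonneg)
    also have "\<dots> = (\<integral>\<^sup>+x. ennreal (g' x) \<partial>\<rho>)"
      unfolding v_def by (intro nn_integral_dens[symmetric] prob ac sets) measurable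
    also have "\<dots> \<le> (\<integral>\<^sup>+x. ?G x \<partial>\<rho>)"
      using g_le g'_eq\<rho> by (intro nn_integral_mono_AE) auto
    finally show ?thesis .
  qed
  then have "enn2ereal (ennreal (Delta \<pi> P K v)) \<le> enn2ereal (\<integral>\<^sup>+x. ?G x \<partial>\<rho>)"
    by (simp add: less_eq_ennreal.rep_eq)
  \<comment> \<open>A negative \<open>Delta\<close> is only raised to \<open>0\<close> by
    \<open>ennreal\<close>.\<close>
  moreover have "ereal (Delta \<pi> P K v) \<le> enn2ereal (ennreal (Delta \<pi> P K v))"
    by (simp add: ennreal.rep_eq)
  ultimately show "ereal (Delta \<pi> P K v) \<le> enn2ereal (\<integral>\<^sup>+x. ?G x \<partial>\<rho>)"
    by (rule order_trans[rotated])
qed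

subsection \<open>The subordinated chain\<close>

lemma subalgebra_past_algebra:
  assumes [measurable]: "\<And>k. X k \<in> borel_measurable M"
  shows "subalgebra M (past_algebra M X k)"
proof -
  have "(\<lambda>\<omega>. \<lambda>i\<in>{..k}. X i \<omega>) \<in> M \<rightarrow>\<^sub>M (\<Pi>\<^sub>M i\<in>{..k}. borel)"
    by measurable
  then show ?thesis
    by (auto simp: subalgebra_def past_algebra_def sets_vimage_algebra
        intro!: sets.sigma_sets_subset measurable_sets)
qed

text \<open>Taking expectations in the Markov property removes the conditioning on the past, and the
  mean of \<open>K (X k) A\<close> is the mass that the bound measure gives to
  \<open>A\<close>.\<close>

lemma markov_chain_step:
  fixes X :: "nat \<Rightarrow> 'w \<Rightarrow> 'a::topological_space"
  assumes chain: "markov_chain M X \<mu>0 K" and K [measurable]: "K \<in> borel \<rightarrow>\<^sub>M prob_algebra borel"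
  shows "distr M borel (X (Suc k)) = distr M borel (X k) \<bind> K"
proof (rule measure_eqI)
  interpret prob_space M using chain by (simp add: markov_chain_def)
  have [measurable]: "X k \<in> borel_measurable M" for k
    using chain by (simp add: markov_chain_def)
  have K' [measurable]: "K \<in> borel \<rightarrow>\<^sub>M subprob_algebra borel"
    using K by (rule measurable_prob_algebraD)
  have prob_K: "prob_space (K x)" for x
    using measurable_space[OF K, of x] by (simp add: space_prob_algebra)
  show "sets (distr M borel (X (Suc k))) = sets (distr M borel (X k) \<bind> K)"
    using sets_bind[of "distr M borel (X k)" K borel] sets_kernel[OF K'] by simp
  fix A assume "A \<in> sets (distr M borel (X (Suc k)))"
  then have [measurable]: "A \<in> sets borel" by simp
  interpret finite_measure_subalgebra M "past_algebra M X k"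
    using subalgebra_past_algebra[of X M k] by unfold_locales auto
  have int: "integrable M (\<lambda>\<omega>. indicator A (X (Suc k) \<omega>) :: real)"
    by (intro integrable_const_bound[of _ 1]) auto
  have AE: "AE \<omega> in M. real_cond_exp M (past_algebra M X k) (\<lambda>\<omega>. indicator A (X (Suc k) \<omega>)) \<omega>
      = measure (K (X k \<omega>)) A"
    using chain by (simp add: markov_chain_def)
  have "(\<lambda>x. measure (K x) A) \<in> borel_measurable borel"
    by measurable
  then have [measurable]: "(\<lambda>\<omega>. measure (K (X k \<omega>)) A) \<in> borel_measurable M"
    by measurable
  have "emeasure (distr M borel (X (Suc k))) A = (\<integral>\<^sup>+\<omega>. indicator A (X (Suc k) \<omega>) \<partial>M)"
    by (subst nn_integral_indicator[symmetric], simp, subst nn_integral_distr) auto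
  also have "\<dots> = ennreal (\<integral>\<omega>. indicator A (X (Suc k) \<omega>) \<partial>M)"
    using int by (subst nn_integral_eq_integral[symmetric]) (auto simp: ennreal_indicator)
  also have "(\<integral>\<omega>. indicator A (X (Suc k) \<omega>) \<partial>M) = (\<integral>\<omega>. measure (K (X k \<omega>)) A \<partial>M)"
    unfolding real_cond_exp_int(2)[OF int, symmetric]
    using AE by (intro integral_cong_AE) auto
  also have "ennreal \<dots> = (\<integral>\<^sup>+\<omega>. ennreal (measure (K (X k \<omega>)) A) \<partial>M)"
    using prob_space.prob_le_1[OF prob_K]
    by (intro nn_integral_eq_integral[symmetric] integrable_const_bound[of _ 1]) auto
  also have "\<dots> = (\<integral>\<^sup>+\<omega>. emeasure (K (X k \<omega>)) A \<partial>M)"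
    using finite_measure.emeasure_eq_measure[OF prob_space.finite_measure[OF prob_K]] by simp
  also have "\<dots> = emeasure (distr M borel (X k) \<bind> K) A"
    by (subst emeasure_bind[where N=borel]) (auto simp: nn_integral_distr)
  finally show "emeasure (distr M borel (X (Suc k))) A = emeasure (distr M borel (X k) \<bind> K) A" .
qed

lemma markov_chain_absolutely_continuous:
  assumes chain: "markov_chain M X \<mu>0 K" and K: "K \<in> borel \<rightarrow>\<^sub>M prob_algebra borel"
    and ac0: "absolutely_continuous \<pi> \<mu>0"
    and step: "\<And>\<mu>. \<mu> \<in> space (prob_algebra borel) \<Longrightarrow> absolutely_continuous \<pi> \<mu> \<Longrightarrow>
      absolutely_continuous \<pi> (\<mu> \<bind> K)"
  shows "absolutely_continuous \<pi> (distr M borel (X k))"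
proof (induction k)
  case 0
  then show ?case using ac0 chain by (simp add: markov_chain_def)
next
  case (Suc k)
  interpret prob_space M using chain by (simp add: markov_chain_def)
  have "X k \<in> borel_measurable M" using chain by (simp add: markov_chain_def)
  then have "distr M borel (X k) \<in> space (prob_algebra borel)"
    by (simp add: space_prob_algebra prob_space_distr)
  then show ?case
    unfolding markov_chain_step[OF chain K] using Suc by (rule step)
qed

section \<open>The law of the chain at a Poisson time\<close>

lemma subordinated_measurable:
  fixes X :: "nat \<Rightarrow> 'w \<Rightarrow> 'a::topological_space"
  assumes [measurable]: "\<And>k. X k \<in> borel_measurable M" and N: "N t \<in> M \<rightarrow>\<^sub>M count_space UNIV"
  shows "(\<lambda>\<omega>. X (N t \<omega>) \<omega>) \<in> borel_measurable M"
  using assms by (intro measurable_compose_countable[of X M borel "N t"]) auto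

text \<open>\<open>N t\<close> takes countably many values, so the event that the subordinated chain
  hits a null set \<open>A\<close> lies in the countable union of the null events
  \<open>X k \<in> A\<close>.\<close>

lemma subordinated_law_absolutely_continuous:
  fixes X :: "nat \<Rightarrow> 'w \<Rightarrow> 'a::topological_space"
  assumes X [measurable]: "\<And>k. X k \<in> borel_measurable M" and N [measurable]: "N t \<in> M \<rightarrow>\<^sub>M count_space UNIV"
    and sets: "sets \<pi> = sets borel"
    and ac: "\<And>k. absolutely_continuous \<pi> (distr M borel (X k))"
  shows "absolutely_continuous \<pi> (subordinated_law M X N t)"
  unfolding absolutely_continuous_def
proof
  fix A assume A: "A \<in> null_sets \<pi>"
  then have [measurable]: "A \<in> sets borel" by (auto simp: sets dest: null_setsD2)
  note [measurable] = subordinated_measurable[of X M N t, OF X N]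
  have "X k -` A \<inter> space M \<in> null_sets M" for k
    using ac[of k] A by (auto simp: absolutely_continuous_def null_sets_distr_iff)
  then have "(\<Union>k. X k -` A \<inter> space M) \<in> null_sets M"
    by (rule null_sets_UN)
  then have "(\<lambda>\<omega>. X (N t \<omega>) \<omega>) -` A \<inter> space M \<in> null_sets M"
    by (rule null_sets_subset) auto
  then show "A \<in> null_sets (subordinated_law M X N t)"
    by (simp add: subordinated_law_def null_sets_distr_iff)
qed

text \<open>Almost surely \<open>N 0 = 0\<close>, so \<open>N t\<close> is the increment from time
  \<open>0\<close>, and its Poisson weight at \<open>0\<close> is read off.\<close>

lemma poisson_process_zero:
  assumes N: "poisson_process M r N" and r: "0 < r" and t: "0 < t"
  shows "measure M (N t -` {0} \<inter> space M) = exp (- (r * t))"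
proof -
  have [measurable]: "N s \<in> M \<rightarrow>\<^sub>M count_space UNIV" if "0 \<le> s" for s
    using N that by (simp add: poisson_process_def)
  have [measurable]: "N 0 \<in> M \<rightarrow>\<^sub>M count_space UNIV" "N t \<in> M \<rightarrow>\<^sub>M count_space UNIV" using t by auto
  have N0: "AE \<omega> in M. N 0 \<omega> = 0"
    using N by (auto simp: poisson_process_def)
  have "measure M (N t -` {0} \<inter> space M) = measure M ((\<lambda>\<omega>. N t \<omega> - N 0 \<omega>) -` {0} \<inter> space M)"
    using N0 by (intro measure_eq_AE) auto
  also have "\<dots> = measure (distr M (count_space UNIV) (\<lambda>\<omega>. N t \<omega> - N 0 \<omega>)) {0}"
    by (subst measure_distr) auto
  also have "\<dots> = measure (measure_pmf (poisson_pmf (r * t))) {0}"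
    using N t by (simp add: poisson_process_def)
  also have "\<dots> = exp (- (r * t))"
    using r t by (simp add: measure_pmf_single)
  finally show ?thesis .
qed

text \<open>On the event \<open>N t = 0\<close> the subordinated chain still sits at
  \<open>X 0\<close>, and independence factorises the probability of this event jointly with
  \<open>X 0 \<in> A\<close>.\<close>

lemma subordinated_law_ge:
  fixes X :: "nat \<Rightarrow> 'w \<Rightarrow> 'a::topological_space"
  assumes N: "poisson_process M r N" and r: "0 < r" and t: "0 < t"
    and X [measurable]: "\<And>k. X k \<in> borel_measurable M" and indep: "indep_processes M X N"
    and A [measurable]: "A \<in> sets borel"
  shows "exp (- (r * t)) * measure (distr M borel (X 0)) A \<le> measure (subordinated_law M X N t) A"
proof -
  interpret prob_space M using N by (simp add: poisson_process_def)
  have Nt [measurable]: "N t \<in> M \<rightarrow>\<^sub>M count_space UNIV"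
    using N t by (simp add: poisson_process_def)
  note [measurable] = subordinated_measurable[of X M N t, OF X Nt]
  \<comment> \<open>Independence is stated for the sigma-algebras generated by whole paths, so each
    of the two events is exhibited as a preimage of a coordinate event under the path map.\<close>
  have 1: "X 0 -` A \<inter> space M
      \<in> sets (vimage_algebra (space M) (\<lambda>\<omega> k. X k \<omega>) (\<Pi>\<^sub>M k\<in>UNIV. borel))"
  proof -
    have "(\<lambda>f. f 0) -` A \<inter> space (\<Pi>\<^sub>M k\<in>UNIV. borel :: 'a measure) \<in> sets (\<Pi>\<^sub>M k\<in>UNIV. borel)"
      by measurable
    from in_vimage_algebra[OF this, of "\<lambda>\<omega> k. X k \<omega>" "space M"] show ?thesis
      by (auto simp: space_PiM vimage_def Int_def cong: conj_cong)
  qed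
  have 2: "N t -` {0} \<inter> space M
      \<in> sets (vimage_algebra (space M) (\<lambda>\<omega>. \<lambda>t\<in>{0..}. N t \<omega>) (\<Pi>\<^sub>M t\<in>{0..}. count_space UNIV))"
  proof -
    have "(\<lambda>f. f t) -` {0} \<inter> space (\<Pi>\<^sub>M t\<in>{0..}. count_space UNIV :: nat measure)
        \<in> sets (\<Pi>\<^sub>M t\<in>{0..}. count_space UNIV)"
      using t by (intro measurable_sets[OF measurable_component_singleton]) auto
    from in_vimage_algebra[OF this, of "\<lambda>\<omega>. \<lambda>t\<in>{0..}. N t \<omega>" "space M"] show ?thesis
      using t by (auto simp: space_PiM vimage_def Int_def cong: conj_cong)
  qed
  have "exp (- (r * t)) * measure (distr M borel (X 0)) A
      = prob (X 0 -` A \<inter> space M) * prob (N t -` {0} \<inter> space M)"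
    by (simp add: poisson_process_zero[OF N r t] measure_distr)
  also have "\<dots> = prob ((X 0 -` A \<inter> space M) \<inter> (N t -` {0} \<inter> space M))"
    using indep 1 2 unfolding indep_processes_def by (intro indep_setD[symmetric])
  also have "\<dots> \<le> prob ((\<lambda>\<omega>. X (N t \<omega>) \<omega>) -` A \<inter> space M)"
    by (intro finite_measure_mono) auto
  also have "\<dots> = measure (subordinated_law M X N t) A"
    by (simp add: subordinated_law_def measure_distr)
  finally show ?thesis .
qed

section \<open>Application to a fixed data set and a fixed time\<close>

theorem proposition15:
  fixes Z :: "'z measure" and n :: nat
    and M :: "'w measure"
    and X :: "(nat \<Rightarrow> 'z) \<Rightarrow> nat \<Rightarrow> 'w \<Rightarrow> real ^ 'd"
    and N :: "real \<Rightarrow> 'w \<Rightarrow> nat"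
    and \<mu>0 \<pi> :: "(real ^ 'd) measure"
    and P :: "real ^ 'd \<Rightarrow> (real ^ 'd) measure"
    and PS :: "(nat \<Rightarrow> 'z) \<Rightarrow> real ^ 'd \<Rightarrow> (real ^ 'd) measure"
    and \<rho> :: "(nat \<Rightarrow> 'z) \<Rightarrow> real \<Rightarrow> (real ^ 'd) measure"
    and v :: "(nat \<Rightarrow> 'z) \<Rightarrow> real \<Rightarrow> real ^ 'd \<Rightarrow> real"
  assumes n: "n \<ge> 1"
    and mu0: "\<mu>0 \<in> space (prob_algebra borel)"
    and PS_kernel: "\<And>S. S \<in> space (\<Pi>\<^sub>M i\<in>{..<n}. Z) \<Longrightarrow> PS S \<in> borel \<rightarrow>\<^sub>M prob_algebra borel"
    and chain: "\<And>S. S \<in> space (\<Pi>\<^sub>M i\<in>{..<n}. Z) \<Longrightarrow> markov_chain M (X S) \<mu>0 (PS S)"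
    and poisson: "poisson_process M 1 N"
    and indep: "\<And>S. S \<in> space (\<Pi>\<^sub>M i\<in>{..<n}. Z) \<Longrightarrow> indep_processes M (X S) N"
    and rho: "\<And>S t. \<rho> S t = subordinated_law M (X S) N t"
    and P_kernel: "P \<in> borel \<rightarrow>\<^sub>M prob_algebra borel"
    and pi: "\<pi> \<in> space (prob_algebra borel)"
    and invariant: "\<pi> \<bind> P = \<pi>"
    and mu0_ac: "absolutely_continuous \<pi> \<mu>0"
    and v: "\<And>S t. v S t = dens \<pi> (\<rho> S t)"
    and compat: "compatible (\<Pi>\<^sub>M i\<in>{..<n}. Z) \<pi> \<mu>0 PS \<rho>"
    and PS_ac: "\<And>x S. S \<in> space (\<Pi>\<^sub>M i\<in>{..<n}. Z) \<Longrightarrow> absolutely_continuous (P x) (PS S x)"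
  shows "\<forall>S\<in>space (\<Pi>\<^sub>M i\<in>{..<n}. Z). \<forall>t>0.
      ereal (Delta \<pi> P (PS S) (v S t))
        \<le> enn2ereal (\<integral>\<^sup>+x. (INF q\<in>{0<..}. ennreal (1 / q) * KL (PS S x) (P x)
                                          + ennreal q * I_ent P (v S t) q x) \<partial>\<rho> S t)
      \<and> (AE x in \<rho> S t.
          ((\<lambda>q. I_ent P (v S t) q x) \<longlongrightarrow> ennreal (prob_space.variance (P x) (\<lambda>y. ln (v S t y)) / 2))
            (at_right 0))"
proof (intro ballI allI impI)
  fix S and t :: real
  assume S: "S \<in> space (\<Pi>\<^sub>M i\<in>{..<n}. Z)" and t: "0 < t"
  note chain = chain[OF S] and K = PS_kernel[OF S]
  interpret M: prob_space M using poisson by (simp add: poisson_process_def)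
  have X: "X S k \<in> borel_measurable M" for k
    using chain by (simp add: markov_chain_def)
  have X0: "distr M borel (X S 0) = \<mu>0"
    using chain by (simp add: markov_chain_def)
  have Nt: "N t \<in> M \<rightarrow>\<^sub>M count_space UNIV"
    using poisson t by (simp add: poisson_process_def)
  have H1: "absolutely_continuous \<pi> (\<mu> \<bind> PS S)"
    if "\<mu> \<in> space (prob_algebra borel)" "absolutely_continuous \<pi> \<mu>" for \<mu>
    using compat S that by (auto simp: compatible_def)
  have H2: "integrable \<pi> (\<lambda>x. Phi (dual_op \<pi> (PS S) (dens \<pi> (\<rho> S t)) x))"
    using compat S t by (auto simp: compatible_def)
  obtain c where c: "0 < c" "AE x in \<pi>. c \<le> dens \<pi> \<mu>0 x"
    using compat by (auto simp: compatible_def)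
  have sets: "sets \<pi> = sets borel" "sets \<mu>0 = sets \<pi>" and prob: "prob_space \<pi>" "prob_space \<mu>0"
    using pi mu0 by (auto simp: space_prob_algebra)
  have \<rho>: "\<rho> S t \<in> space (prob_algebra borel)"
    unfolding rho subordinated_law_def
    using M.prob_space_distr[OF subordinated_measurable[of "X S" M N t, OF X Nt]]
    by (simp add: space_prob_algebra)
  then have prob_\<rho>: "prob_space (\<rho> S t)" "sets (\<rho> S t) = sets \<pi>"
    by (auto simp: space_prob_algebra sets)
  have ac: "absolutely_continuous \<pi> (\<rho> S t)"
    unfolding rho
    by (intro subordinated_law_absolutely_continuous X Nt sets
        markov_chain_absolutely_continuous[OF chain K mu0_ac H1])
  \<comment> \<open>The factor is the probability of no jump before \<open>t\<close> at intensity
    \<open>1\<close>, kept in the form \<open>r * t\<close> with \<open>r = 1\<close>.\<close>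
  have "AE x in \<pi>. exp (- (1 * t)) * c \<le> dens \<pi> (\<rho> S t) x"
  proof (rule AE_dens_ge[OF prob prob_\<rho>(1) mu0_ac sets(2) ac prob_\<rho>(2) _ _ c(2)])
    fix A assume "A \<in> sets \<pi>"
    then show "exp (- (1 * t)) * measure \<mu>0 A \<le> measure (\<rho> S t) A"
      unfolding rho X0[symmetric]
      by (intro subordinated_law_ge[OF poisson _ t X indep[OF S]]) (auto simp: sets)
  qed simp
  note lower = this
  have c': "0 < exp (- (1 * t)) * c" using c by simp
  note * = Delta_le_and_I_ent_tendsto[OF pi \<rho> P_kernel K invariant ac H1[OF \<rho> ac] PS_ac[OF S] c' lower H2]
  show "ereal (Delta \<pi> P (PS S) (v S t))
        \<le> enn2ereal (\<integral>\<^sup>+x. (INF q\<in>{0<..}. ennreal (1 / q) * KL (PS S x) (P x)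
                                          + ennreal q * I_ent P (v S t) q x) \<partial>\<rho> S t)
      \<and> (AE x in \<rho> S t.
          ((\<lambda>q. I_ent P (v S t) q x) \<longlongrightarrow> ennreal (prob_space.variance (P x) (\<lambda>y. ln (v S t y)) / 2))
            (at_right 0))"
    unfolding v using * by blast
qed

end
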